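(* Let $A\subset\mathbb{R}^d$ be a finite point set and let $\mathcal{K}$ be a simplicial subcomplex of the face complex of $\mathrm{conv}(A)$ (every $F\in\mathcal{K}$ is a simplex and $F\cap A$ is exactly the vertex set of $F$). Let $I=[0,1]$. Then the triangulations of $\mathcal{K}\times I$ are in bijection with the locally acyclic orientations of the 1-skeleton of $\mathcal{K}$, and flips between triangulations of $\mathcal{K}\times I$ correspond to pairs of locally acyclic orientations differing in the reversal of a single edge.
   Context: A triangulation of $\mathcal{K}\times I$ is a geometric simplicial complex $T$ with vertex set contained in $A\times\{0,1\}\subset\mathbb{R}^{d+1}$ such that every simplex of $T$ is contained in $F\times I$ for some $F\in\mathcal{K}$, and the union of the simplices of $T$ equals $\bigcup_{F\in\mathcal{K}}F\times I$. Flips are defined as for point sets: for a minimal affinely dependent set $Z$ of points with its unique partition $Z=Z^+\sqcup Z^-$ such that $\mathrm{conv}(Z^+)\cap\mathrm{conv}(Z^-)\ne\emptyset$, let $T_+(Z)=\{S\subseteq Z: Z^+\not\subseteq S\}$ and $T_-(Z)=\{S\subseteq Z: Z^-\not\subseteq S\}$; if $T_+(Z)$ is a subcomplex of $T$ and all maximal simplices of $T_+(Z)$ have the same link $L$ in $T$, replacing $T_+(Z)*L$ by $T_-(Z)*L$ (join of complexes) is a flip. A locally acyclic orientation of the 1-skeleton of a simplicial complex is an orientation of all its edges whose restriction to every simplex is acyclic. *)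

theory Defs
  imports "HOL-Analysis.Analysis"
begin

section \<open>Geometric simplicial complexes and their vertex sets\<close>

text \<open>
  The library predicate \<open>simplicial_complex\<close> also admits the void family without any simplex.
  Here every complex contains the empty simplex (a \<open>- 1\<close>-simplex in the library); the families
  \<open>T\<^sub>+(Z)\<close> and \<open>T\<^sub>-(Z)\<close> below contain the empty set as well.
\<close>

definition geometric_complex :: "'a::euclidean_space set set \<Rightarrow> bool" where
  "geometric_complex C \<longleftrightarrow> simplicial_complex C \<and> {} \<in> C"

definition vertices :: "'a::euclidean_space set \<Rightarrow> 'a set" where
  "vertices F = {x. x extreme_point_of F}"

definition simplicial_subcomplex_of_faces ::
    "'a::euclidean_space set \<Rightarrow> 'a set set \<Rightarrow> bool" where
  "simplicial_subcomplex_of_faces A K \<longleftrightarrow>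
     geometric_complex K \<and>
     (\<forall>F\<in>K. F face_of (convex hull A) \<and> F \<inter> A = vertices F)"

section \<open>Triangulations of the prism over a complex\<close>

text \<open>The space \<open>\<real>\<^bsup>d+1\<^esup>\<close> is the product of the ambient space of \<open>A\<close> with the real line.\<close>

definition prism_triangulation ::
    "'a::euclidean_space set \<Rightarrow> 'a set set \<Rightarrow> ('a \<times> real) set set \<Rightarrow> bool" where
  "prism_triangulation A K T \<longleftrightarrow>
     geometric_complex T \<and>
     (\<forall>S\<in>T. vertices S \<subseteq> A \<times> {0, 1}) \<and>
     (\<forall>S\<in>T. \<exists>F\<in>K. S \<subseteq> F \<times> {0..1}) \<and>
     \<Union> T = (\<Union>F\<in>K. F \<times> {0..1})"

section \<open>Flips\<close>

text \<open>Flips are described in terms of vertex sets: a simplex is identified with the set of its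
  vertices, and a geometric complex with the family of the vertex sets of its simplices.\<close>

definition vertex_scheme :: "'a::euclidean_space set set \<Rightarrow> 'a set set" where
  "vertex_scheme T = vertices ` T"

definition minimal_affine_dependent :: "'a::euclidean_space set \<Rightarrow> bool" where
  "minimal_affine_dependent Z \<longleftrightarrow> affine_dependent Z \<and> (\<forall>Y. Y \<subset> Z \<longrightarrow> \<not> affine_dependent Y)"

text \<open>The partition is unique up to exchanging the two parts; both labellings are admitted.\<close>

definition circuit_partition ::
    "'a::euclidean_space set \<Rightarrow> 'a set \<Rightarrow> 'a set \<Rightarrow> bool" where
  "circuit_partition Z Zp Zm \<longleftrightarrow>
     minimal_affine_dependent Z \<and> Z = Zp \<union> Zm \<and> Zp \<inter> Zm = {} \<and>
     (convex hull Zp) \<inter> (convex hull Zm) \<noteq> {}"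

text \<open>\<open>T\<^sub>+(Z)\<close> is \<open>subsets_avoiding Z Zp\<close> and \<open>T\<^sub>-(Z)\<close> is \<open>subsets_avoiding Z Zm\<close>.\<close>

definition subsets_avoiding :: "'a set \<Rightarrow> 'a set \<Rightarrow> 'a set set" where
  "subsets_avoiding Z Y = {S. S \<subseteq> Z \<and> \<not> Y \<subseteq> S}"

definition maximal_simplices :: "'a set set \<Rightarrow> 'a set set" where
  "maximal_simplices C = {S \<in> C. \<forall>R\<in>C. S \<subseteq> R \<longrightarrow> R = S}"

definition simplex_link :: "'a set set \<Rightarrow> 'a set \<Rightarrow> 'a set set" where
  "simplex_link C S = {R \<in> C. R \<inter> S = {} \<and> R \<union> S \<in> C}"

definition complex_join :: "'a set set \<Rightarrow> 'a set set \<Rightarrow> 'a set set" where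
  "complex_join C D = {S \<union> R |S R. S \<in> C \<and> R \<in> D}"

definition flip ::
    "'a::euclidean_space set \<Rightarrow> 'a set set \<Rightarrow> 'a set set \<Rightarrow> bool" where
  "flip P T T' \<longleftrightarrow>
     (\<exists>Z Zp Zm L.
        Z \<subseteq> P \<and> circuit_partition Z Zp Zm \<and>
        subsets_avoiding Z Zp \<subseteq> vertex_scheme T \<and>
        (\<forall>M \<in> maximal_simplices (subsets_avoiding Z Zp). simplex_link (vertex_scheme T) M = L) \<and>
        vertex_scheme T' =
          (vertex_scheme T - complex_join (subsets_avoiding Z Zp) L)
            \<union> complex_join (subsets_avoiding Z Zm) L)"

section \<open>Locally acyclic orientations\<close>

definition edges :: "'a::euclidean_space set set \<Rightarrow> 'a set set" where
  "edges K = {{u, v} |u v. u \<noteq> v \<and> closed_segment u v \<in> K}"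

text \<open>An orientation is the set of its arcs \<open>(u, v)\<close>, read as \<open>u \<rightarrow> v\<close>.\<close>

definition orientation :: "'a::euclidean_space set set \<Rightarrow> ('a \<times> 'a) set \<Rightarrow> bool" where
  "orientation K D \<longleftrightarrow>
     (\<forall>(u, v) \<in> D. {u, v} \<in> edges K) \<and>
     (\<forall>u v. {u, v} \<in> edges K \<longrightarrow> ((u, v) \<in> D \<longleftrightarrow> (v, u) \<notin> D))"

definition locally_acyclic_orientation ::
    "'a::euclidean_space set set \<Rightarrow> ('a \<times> 'a) set \<Rightarrow> bool" where
  "locally_acyclic_orientation K D \<longleftrightarrow>
     orientation K D \<and> (\<forall>F\<in>K. acyclic (D \<inter> vertices F \<times> vertices F))"

definition single_edge_reversal :: "('a \<times> 'a) set \<Rightarrow> ('a \<times> 'a) set \<Rightarrow> bool" where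
  "single_edge_reversal D D' \<longleftrightarrow> (\<exists>u v. (u, v) \<in> D \<and> D' = insert (v, u) (D - {(u, v)}))"

end

theory Submission
  imports Defs
begin

text \<open>
  A point over a face with vertex set \<open>V\<close> is given by barycentric coordinates \<open>l\<close> on \<open>V\<close> and a height
  \<open>t\<close>; to place it in a simplex of a prism triangulation is to split \<open>l\<close> between the two layers so
  that the upper layer carries total mass \<open>t\<close>. An orientation selects the simplices in which \<open>a\<close> below
  and \<open>b\<close> above occur together only if \<open>a = b\<close> or \<open>a \<rightarrow> b\<close>. Within these the split is
  unique, because two different splits would force arcs \<open>a \<rightarrow> b\<close> and \<open>b \<rightarrow> a\<close>; it exists,
  because the mass can be lifted greedily, starting at a sink of \<open>V\<close>. Conversely, a triangulation
  contains exactly one diagonal of each square \<open>{a, b} \<times> I\<close>, hence defines an orientation, and a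
  simplex that contains a point just above the barycentre of a face shows that every face has a
  sink, which is local acyclicity. Since flips replace one circuit by its opposite and the circuits
  that can occur are the pairs of diagonals of such squares, flips are single edge reversals.
\<close>

section \<open>Barycentric coordinates and geometric complexes\<close>

text \<open>Weights are total functions that vanish off \<open>S\<close>. Representations over
  different vertex sets can then be compared as functions, and the condition that two simplices meet
  in a common face becomes an equation \<open>w = w'\<close>.\<close>

definition bary :: "'a::euclidean_space set \<Rightarrow> ('a \<Rightarrow> real) \<Rightarrow> 'a \<Rightarrow> bool" where
  "bary S w p \<longleftrightarrow> finite S \<and> (\<forall>x. 0 \<le> w x) \<and> (\<forall>x. x \<notin> S \<longrightarrow> w x = 0) \<and>
     sum w S = 1 \<and> (\<Sum>x\<in>S. w x *\<^sub>R x) = p"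

lemma ex_bary_iff: "finite S \<Longrightarrow> (\<exists>w. bary S w p) \<longleftrightarrow> p \<in> convex hull S"
proof
  assume "finite S" "p \<in> convex hull S"
  then obtain u where u: "\<forall>x\<in>S. 0 \<le> u x" "sum u S = 1" "(\<Sum>x\<in>S. u x *\<^sub>R x) = p"
    by (auto simp: convex_hull_finite)
  have "bary S (\<lambda>x. if x \<in> S then u x else 0) p"
    using u \<open>finite S\<close> by (auto simp: bary_def cong: sum.cong)
  then show "\<exists>w. bary S w p" by blast
qed (auto simp: bary_def convex_hull_finite)

lemma bary_extend:
  assumes "bary S w p" "S \<subseteq> S'" "finite S'"
  shows "bary S' w p"
proof -
  have "sum w S' = sum w S" "(\<Sum>x\<in>S'. w x *\<^sub>R x) = (\<Sum>x\<in>S. w x *\<^sub>R x)"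
    using assms by (intro sum.mono_neutral_right; auto simp: bary_def)+
  then show ?thesis using assms unfolding bary_def by (metis subset_iff)
qed

lemma bary_restrict:
  assumes "bary S w p" "S' \<subseteq> S" "\<And>x. x \<notin> S' \<Longrightarrow> w x = 0"
  shows "bary S' w p"
proof -
  have "sum w S = sum w S'" "(\<Sum>x\<in>S. w x *\<^sub>R x) = (\<Sum>x\<in>S'. w x *\<^sub>R x)"
    using assms by (intro sum.mono_neutral_right; auto simp: bary_def)+
  then show ?thesis using assms unfolding bary_def by (metis finite_subset)
qed

lemma bary_support: "bary S w p \<Longrightarrow> bary {x. w x \<noteq> 0} w p"
  by (rule bary_restrict) (auto simp: bary_def)

lemma bary_imp_hull: "bary S w p \<Longrightarrow> p \<in> convex hull S"
  using ex_bary_iff[of S p] by (auto simp: bary_def)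

lemma bary_pos: "bary S w p \<Longrightarrow> w x \<noteq> 0 \<Longrightarrow> 0 < w x \<and> x \<in> S"
  by (auto simp: bary_def less_le)

lemma bary_unique:
  assumes "\<not> affine_dependent S" "bary S w p" "bary S w' p"
  shows "w = w'"
proof (rule ccontr)
  assume "w \<noteq> w'"
  then obtain x where x: "w x \<noteq> w' x" by auto
  have fin: "finite S" using assms(2) by (simp add: bary_def)
  have "x \<in> S" using x assms unfolding bary_def by metis
  moreover have "(\<Sum>x\<in>S. w x - w' x) = 0" "(\<Sum>x\<in>S. (w x - w' x) *\<^sub>R x) = 0"
    using assms by (auto simp: bary_def sum_subtractf scaleR_diff_left)
  ultimately have "affine_dependent S"
    unfolding affine_dependent_explicit_finite[OF fin] using x by (intro exI[of _ "\<lambda>x. w x - w' x"]) auto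
  with assms show False by simp
qed

text \<open>By Radon, a dependent set has two disjoint parts whose hulls share a point. Its two
  weight functions have disjoint supports, so if they were equal they would vanish, against total
  mass 1.\<close>

lemma affine_independent_if_bary_unique:
  assumes "finite S" "\<And>w w' p. bary S w p \<Longrightarrow> bary S w' p \<Longrightarrow> w = w'"
  shows "\<not> affine_dependent S"
proof
  assume "affine_dependent S"
  then obtain M P p where M: "M \<inter> P = {}" "M \<union> P = S" "p \<in> convex hull M" "p \<in> convex hull P"
    using Radon_partition[OF assms(1)] by blast
  have fin: "finite M" "finite P" using M assms(1) by auto
  obtain w w' where w: "bary M w p" "bary P w' p"
    using M fin by (metis ex_bary_iff)
  then have "w = w'" using assms M bary_extend by blast
  then have "w = (\<lambda>_. 0)" using w M(1) by (auto simp: bary_def fun_eq_iff)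
  then show False using w by (simp add: bary_def)
qed

section \<open>Geometric complexes described by their vertex sets\<close>

lemma vertices_hull: "\<not> affine_dependent S \<Longrightarrow> vertices (convex hull S) = S"
  by (auto simp: vertices_def extreme_point_of_convex_hull_affine_independent)

lemma complex_vertices:
  assumes "geometric_complex C" "F \<in> C"
  shows "\<not> affine_dependent (vertices F)" "finite (vertices F)" "convex hull (vertices F) = F"
proof -
  obtain S where "\<not> affine_dependent S" "F = convex hull S"
    using assms by (force simp: geometric_complex_def simplicial_complex_def simplex_def)
  then show "\<not> affine_dependent (vertices F)" "convex hull (vertices F) = F"
    by (auto simp: vertices_hull)
  then show "finite (vertices F)" using aff_independent_finite by blast
qed

lemma scheme_hull:
  assumes "geometric_complex C" "S \<in> vertex_scheme C"
  shows "\<not> affine_dependent S" "finite S" "convex hull S \<in> C" "vertices (convex hull S) = S"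
  using assms complex_vertices unfolding vertex_scheme_def by fastforce+

lemma complex_eq_hulls: "geometric_complex C \<Longrightarrow> C = (hull) convex ` vertex_scheme C"
  using complex_vertices by (force simp: vertex_scheme_def image_iff)

lemma in_scheme_iff:
  assumes "geometric_complex C" "\<not> affine_dependent S"
  shows "S \<in> vertex_scheme C \<longleftrightarrow> convex hull S \<in> C"
  using assms scheme_hull(3) vertices_hull[OF assms(2)] by (metis image_eqI vertex_scheme_def)

lemma scheme_subset:
  assumes "geometric_complex C" "S \<in> vertex_scheme C" "R \<subseteq> S"
  shows "R \<in> vertex_scheme C"
proof -
  note S = scheme_hull[OF assms(1,2)]
  have R: "\<not> affine_dependent R" using S assms(3) affine_dependent_subset by blast
  have "convex hull R face_of convex hull S"
    using S(1) assms(3) face_of_convex_hull_affine_independent by blast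
  then have "convex hull R \<in> C"
    using assms(1) S(3) by (auto simp: geometric_complex_def simplicial_complex_def)
  then show ?thesis by (simp add: in_scheme_iff assms R)
qed

lemma empty_in_scheme: "geometric_complex C \<Longrightarrow> {} \<in> vertex_scheme C"
  using in_scheme_iff[of C "{}"] by (simp add: geometric_complex_def)

text \<open>The two simplices meet in a common face, whose vertex set lies in both \<open>S\<close>
  and \<open>S'\<close>. The coordinates of \<open>p\<close> on that face extend to both simplices,
  where affine independence makes them equal to \<open>w\<close> and to \<open>w'\<close>.\<close>

lemma scheme_bary_unique:
  assumes C: "geometric_complex C" and S: "S \<in> vertex_scheme C" and S': "S' \<in> vertex_scheme C"
    and w: "bary S w p" and w': "bary S' w' p"
  shows "w = w'"
proof -
  note hS = scheme_hull[OF C S] and hS' = scheme_hull[OF C S']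
  have "convex hull S \<inter> convex hull S' face_of convex hull S"
       "convex hull S \<inter> convex hull S' face_of convex hull S'"
    using C hS(3) hS'(3) unfolding geometric_complex_def simplicial_complex_def by (metis inf_commute)+
  then obtain R R' where R: "R \<subseteq> S" "convex hull S \<inter> convex hull S' = convex hull R"
    "R' \<subseteq> S'" "convex hull R' = convex hull R"
    unfolding face_of_convex_hull_affine_independent[OF hS(1)] face_of_convex_hull_affine_independent[OF hS'(1)]
    by auto
  moreover have "\<not> affine_dependent R" "\<not> affine_dependent R'"
    using R hS(1) hS'(1) affine_dependent_subset by blast+
  ultimately have "R = R'"
    by (metis vertices_hull)
  have "p \<in> convex hull R" using w w' R(2) bary_imp_hull by blast
  moreover have "finite R" using R(1) hS(2) finite_subset by blast
  ultimately obtain v where v: "bary R v p" using ex_bary_iff by blast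
  have "bary S v p" "bary S' v p"
    using v R \<open>R = R'\<close> hS(2) hS'(2) bary_extend by blast+
  then have "w = v" "w' = v"
    using w w' bary_unique[OF hS(1)] bary_unique[OF hS'(1)] by blast+
  then show ?thesis by simp
qed

text \<open>Converse of \<open>scheme_bary_unique\<close>, by which complexes are built. The case
  \<open>S = S'\<close> of \<open>uniq\<close> gives affine independence; in general a common point
  has weights supported on \<open>S \<inter> S'\<close>, so the hulls meet in the hull of
  \<open>S \<inter> S'\<close>, a face of both.\<close>

lemma geometric_complex_if_bary_unique:
  fixes X :: "'a::euclidean_space set set"
  assumes fin: "finite X" "\<And>S. S \<in> X \<Longrightarrow> finite S" and emp: "{} \<in> X"
    and sub: "\<And>S R. S \<in> X \<Longrightarrow> R \<subseteq> S \<Longrightarrow> R \<in> X"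
    and uniq: "\<And>S S' w w' p. S \<in> X \<Longrightarrow> S' \<in> X \<Longrightarrow> bary S w p \<Longrightarrow> bary S' w' p \<Longrightarrow> w = w'"
  shows "geometric_complex ((hull) convex ` X)" "vertex_scheme ((hull) convex ` X) = X"
proof -
  have ind: "\<not> affine_dependent S" if "S \<in> X" for S
    by (rule affine_independent_if_bary_unique[OF fin(2)[OF that] uniq[OF that that]])
  have inter: "convex hull S \<inter> convex hull S' = convex hull (S \<inter> S')" if S: "S \<in> X" "S' \<in> X" for S S'
  proof
    show "convex hull S \<inter> convex hull S' \<subseteq> convex hull (S \<inter> S')"
    proof
      fix p assume "p \<in> convex hull S \<inter> convex hull S'"
      then obtain w w' where w: "bary S w p" "bary S' w' p"
        using S fin(2) ex_bary_iff by (metis IntE)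
      then have "w = w'" using uniq S by blast
      then have "bary (S \<inter> S') w p"
        using w by (intro bary_restrict[OF w(1)]) (auto simp: bary_def)
      then show "p \<in> convex hull (S \<inter> S')" by (rule bary_imp_hull)
    qed
  qed (simp add: hull_mono)
  have "\<exists>n. n simplex convex hull S" if "S \<in> X" for S
    using ind[OF that] simplex_convex_hull[of S "int (card S) - 1"] by auto
  moreover have "F \<in> (hull) convex ` X" if "S \<in> X" "F face_of convex hull S" for F S
    using that ind face_of_convex_hull_affine_independent sub by (metis image_eqI)
  moreover have "convex hull S \<inter> convex hull S' face_of convex hull S" if "S \<in> X" "S' \<in> X" for S S'
    using inter[OF that] ind[OF that(1)] face_of_convex_hull_affine_independent by (metis inf_le1)
  ultimately show "geometric_complex ((hull) convex ` X)"
    using fin(1) emp by (auto simp: geometric_complex_def simplicial_complex_def image_iff intro: bexI[of _ "{}"])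
  show "vertex_scheme ((hull) convex ` X) = X"
    unfolding vertex_scheme_def image_image using ind vertices_hull by (auto simp: image_iff)
qed

section \<open>Splitting barycentric coordinates between two layers\<close>

text \<open>The base point depends only on the total weight of each fibre
  \<open>{(v, 0), (v, 1)}\<close>, and the height only on the upper weights. Representing
  \<open>(x, t)\<close> thus means splitting coordinates of \<open>x\<close> with upper mass
  \<open>t\<close>.\<close>

lemma bary_prism:
  fixes w :: "'a::euclidean_space \<times> real \<Rightarrow> real"
  assumes "finite V" and S: "S \<subseteq> V \<times> {0, 1}"
  shows "bary S w (x, t) \<longleftrightarrow>
    (\<forall>p. 0 \<le> w p) \<and> (\<forall>p. p \<notin> S \<longrightarrow> w p = 0) \<and>
    bary V (\<lambda>v. w (v, 0) + w (v, 1)) x \<and> (\<Sum>v\<in>V. w (v, 1)) = t"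
    (is "_ \<longleftrightarrow> ?R")
proof -
  have fin: "finite S" using assms finite_subset[OF S] by simp
  have split: "(\<Sum>p\<in>V \<times> {0, 1}. h p) = (\<Sum>v\<in>V. h (v, 0) + h (v, 1))"
    for h :: "'a \<times> real \<Rightarrow> 'b::comm_monoid_add"
    by (simp add: sum.cartesian_product')
  have ext: "bary S w (x, t) \<longleftrightarrow> (\<forall>p. p \<notin> S \<longrightarrow> w p = 0) \<and> bary (V \<times> {0, 1}) w (x, t)"
  proof (intro iffI conjI)
    assume "bary S w (x, t)"
    then show "bary (V \<times> {0, 1}) w (x, t)" using bary_extend[OF _ S] assms(1) by blast
  qed (use bary_restrict[OF _ S] in \<open>auto simp: bary_def\<close>)
  have sums: "sum w (V \<times> {0, 1}) = (\<Sum>v\<in>V. w (v, 0) + w (v, 1))"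
    "(\<Sum>p\<in>V \<times> {0, 1}. w p *\<^sub>R p)
      = ((\<Sum>v\<in>V. (w (v, 0) + w (v, 1)) *\<^sub>R v), (\<Sum>v\<in>V. w (v, 1)))"
    unfolding split by (auto simp: prod_eq_iff fst_sum snd_sum scaleR_add_left)
  have off: "w (v, 0) = 0 \<and> w (v, 1) = 0" if "\<forall>p. p \<notin> S \<longrightarrow> w p = 0" "v \<notin> V" for v
    using that S by auto
  have off': "w p = 0" if "\<forall>p. p \<notin> S \<longrightarrow> w p = 0" "p \<notin> V \<times> {0, 1}" for p
    using that S by blast
  show ?thesis
  proof (cases "(\<forall>p. 0 \<le> w p) \<and> (\<forall>p. p \<notin> S \<longrightarrow> w p = 0)")
    case True
    have prism: "finite (V \<times> {0, 1::real})" "\<forall>p. p \<notin> V \<times> {0, 1} \<longrightarrow> w p = 0"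
      using assms(1) off' True by blast+
    have base: "\<forall>v. 0 \<le> w (v, 0) + w (v, 1)" "\<forall>v. v \<notin> V \<longrightarrow> w (v, 0) + w (v, 1) = 0"
      using True off by (simp_all add: add_nonneg_nonneg)
    show ?thesis
      unfolding ext unfolding bary_def sums prod.inject using True prism base assms(1) by blast
  next
    case False
    then show ?thesis by (auto simp: bary_def)
  qed
qed

text \<open>The weights are pushed towards the sinks first.\<close>

lemma ex_distribution:
  fixes l :: "'a \<Rightarrow> real"
  assumes "finite V" "\<And>v. v \<in> V \<Longrightarrow> 0 \<le> l v" "0 \<le> t" "t \<le> sum l V"
    and sink: "\<And>W. W \<subseteq> V \<Longrightarrow> W \<noteq> {} \<Longrightarrow> \<exists>m\<in>W. \<forall>a\<in>W. a \<noteq> m \<longrightarrow> (a, m) \<in> D"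
  shows "\<exists>b. (\<forall>v\<in>V. 0 \<le> b v \<and> b v \<le> l v) \<and> sum b V = t \<and>
    (\<forall>u\<in>V. \<forall>v\<in>V. u \<noteq> v \<longrightarrow> b u < l u \<longrightarrow> 0 < b v \<longrightarrow> (u, v) \<in> D)"
  using assms
proof (induction "card V" arbitrary: V t)
  case 0
  then show ?case by auto
next
  case (Suc n)
  then have "V \<noteq> {}" by auto
  then obtain m where m: "m \<in> V" "\<forall>a\<in>V. a \<noteq> m \<longrightarrow> (a, m) \<in> D" using Suc.prems(5) by blast
  have V: "sum f V = f m + sum f (V - {m})" for f :: "'a \<Rightarrow> real"
    using m(1) Suc.prems(1) by (rule sum.remove[rotated])
  show ?case
  proof (cases "t \<le> l m")
    case True
    \<comment> \<open>All the mass fits on the sink: the only positive value sits at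
      \<open>m\<close>, and every other vertex has an arc to \<open>m\<close>.\<close>
    define b where "b = (\<lambda>v. if v = m then t else 0)"
    have "sum b (V - {m}) = 0" by (rule sum.neutral) (auto simp: b_def)
    then have "sum b V = t" unfolding V by (simp add: b_def)
    moreover have "\<forall>v\<in>V. 0 \<le> b v \<and> b v \<le> l v"
      using True Suc.prems(2,3) by (auto simp: b_def)
    moreover have "\<forall>u\<in>V. \<forall>v\<in>V. u \<noteq> v \<longrightarrow> b u < l u \<longrightarrow> 0 < b v \<longrightarrow> (u, v) \<in> D"
      using m by (auto simp: b_def)
    ultimately show ?thesis by blast
  next
    case False
    have "\<exists>b. (\<forall>v\<in>V - {m}. 0 \<le> b v \<and> b v \<le> l v) \<and> sum b (V - {m}) = t - l m \<and>
      (\<forall>u\<in>V - {m}. \<forall>v\<in>V - {m}. u \<noteq> v \<longrightarrow> b u < l u \<longrightarrow> 0 < b v \<longrightarrow> (u, v) \<in> D)"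
    proof (rule Suc.hyps(1))
      show "n = card (V - {m})" using Suc.hyps(2) m(1) Suc.prems(1) by simp
      show "t - l m \<le> sum l (V - {m})" using Suc.prems(4) V[of l] by simp
      show "\<exists>m\<in>W. \<forall>a\<in>W. a \<noteq> m \<longrightarrow> (a, m) \<in> D" if "W \<subseteq> V - {m}" "W \<noteq> {}" for W
        using that Suc.prems(5)[of W] by blast
    qed (use Suc.prems False in auto)
    then obtain b where b: "\<forall>v\<in>V - {m}. 0 \<le> b v \<and> b v \<le> l v" "sum b (V - {m}) = t - l m"
      "\<forall>u\<in>V - {m}. \<forall>v\<in>V - {m}. u \<noteq> v \<longrightarrow> b u < l u \<longrightarrow> 0 < b v \<longrightarrow> (u, v) \<in> D" by blast
    \<comment> \<open>The sink is filled up. It leaves no room below, so it never needs an outgoing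
      arc, and the arcs into it exist.\<close>
    define c where "c = b(m := l m)"
    have "sum c (V - {m}) = sum b (V - {m})" by (rule sum.cong) (auto simp: c_def)
    then have "sum c V = t" unfolding V using b(2) by (simp add: c_def)
    moreover have "\<forall>v\<in>V. 0 \<le> c v \<and> c v \<le> l v" using b(1) m(1) Suc.prems(2) by (auto simp: c_def)
    moreover have "\<forall>u\<in>V. \<forall>v\<in>V. u \<noteq> v \<longrightarrow> c u < l u \<longrightarrow> 0 < c v \<longrightarrow> (u, v) \<in> D"
      using b(3) m by (auto simp: c_def)
    ultimately show ?thesis by blast
  qed
qed

text \<open>If \<open>b x < b' x\<close> and \<open>b' y < b y\<close>, then \<open>b\<close> leaves
  room at \<open>x\<close> and is positive at \<open>y\<close>, which forces x -> y, and
  \<open>b'\<close> likewise forces y -> x. So one distribution dominates the other, and equal sums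
  make them equal.\<close>

lemma distribution_unique:
  fixes l b b' :: "'a \<Rightarrow> real"
  assumes "finite V" and anti: "\<And>u v. (u, v) \<in> D \<Longrightarrow> (v, u) \<notin> D"
    and b: "\<And>v. v \<in> V \<Longrightarrow> 0 \<le> b v" "\<And>v. v \<in> V \<Longrightarrow> b v \<le> l v"
      "\<And>u v. \<lbrakk>u \<in> V; v \<in> V; u \<noteq> v; b u < l u; 0 < b v\<rbrakk> \<Longrightarrow> (u, v) \<in> D"
    and b': "\<And>v. v \<in> V \<Longrightarrow> 0 \<le> b' v" "\<And>v. v \<in> V \<Longrightarrow> b' v \<le> l v"
      "\<And>u v. \<lbrakk>u \<in> V; v \<in> V; u \<noteq> v; b' u < l u; 0 < b' v\<rbrakk> \<Longrightarrow> (u, v) \<in> D"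
    and sums: "sum b V = sum b' V" and v: "v \<in> V"
  shows "b v = b' v"
proof -
  have le: "\<not> (\<exists>x\<in>V. b x < b' x) \<or> \<not> (\<exists>y\<in>V. b' y < b y)"
  proof (rule ccontr)
    assume "\<not> ?thesis"
    then obtain x y where xy: "x \<in> V" "y \<in> V" "b x < b' x" "b' y < b y" by blast
    then have "x \<noteq> y" by auto
    have "(x, y) \<in> D" using b(3)[of x y] b'(1)[of y] b'(2)[of x] xy \<open>x \<noteq> y\<close> by linarith
    moreover have "(y, x) \<in> D" using b'(3)[of y x] b(1)[of x] b(2)[of y] xy \<open>x \<noteq> y\<close>[symmetric] by linarith
    ultimately show False using anti by blast
  qed
  then consider "\<forall>x\<in>V. b' x \<le> b x" | "\<forall>x\<in>V. b x \<le> b' x" by force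
  then show ?thesis
  proof cases
    case 1
    then have "(\<Sum>x\<in>V. b x - b' x) = 0 \<longleftrightarrow> (\<forall>x\<in>V. b x - b' x = 0)"
      using assms(1) by (intro sum_nonneg_eq_0_iff) auto
    then show ?thesis using sums v by (simp add: sum_subtractf)
  next
    case 2
    then have "(\<Sum>x\<in>V. b' x - b x) = 0 \<longleftrightarrow> (\<forall>x\<in>V. b' x - b x = 0)"
      using assms(1) by (intro sum_nonneg_eq_0_iff) auto
    then show ?thesis using sums v by (simp add: sum_subtractf)
  qed
qed

section \<open>Locally acyclic orientations and staircase simplices\<close>

lemma in_edges_iff:
  assumes "geometric_complex K"
  shows "{u, v} \<in> edges K \<longleftrightarrow> u \<noteq> v \<and> {u, v} \<in> vertex_scheme K"
proof -
  have "closed_segment u v \<in> K \<longleftrightarrow> {u, v} \<in> vertex_scheme K" for u v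
    using in_scheme_iff[OF assms affine_independent_2] by (simp add: segment_convex_hull)
  then show ?thesis unfolding edges_def by (auto simp: doubleton_eq_iff insert_commute)
qed

text \<open>If \<open>D\<close> orders a face as v1 -> ... -> vn, the maximal sets over it are v1,
  ..., vi below together with vi, ..., vn above: the staircase triangulation of a simplex times an
  interval.\<close>

definition staircase_scheme ::
    "'a set set \<Rightarrow> ('a \<times> 'a) set \<Rightarrow> ('a \<times> real) set set" where
  "staircase_scheme X D = {S. S \<subseteq> UNIV \<times> {0, 1} \<and> fst ` S \<in> X \<and>
     (\<forall>a b. (a, 0) \<in> S \<longrightarrow> (b, 1) \<in> S \<longrightarrow> a = b \<or> (a, b) \<in> D)}"

definition triangulation_arcs :: "('a::euclidean_space \<times> real) set set \<Rightarrow> ('a \<times> 'a) set" where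
  "triangulation_arcs T = {(a, b). a \<noteq> b \<and> {(a, 0), (b, 1)} \<in> vertex_scheme T}"

lemma orientation_arc:
  assumes "geometric_complex K" "orientation K D"
  shows "(a, b) \<in> D \<Longrightarrow> a \<noteq> b \<and> {a, b} \<in> vertex_scheme K"
    and "a \<noteq> b \<Longrightarrow> {a, b} \<in> vertex_scheme K \<Longrightarrow> (a, b) \<in> D \<longleftrightarrow> (b, a) \<notin> D"
  using assms in_edges_iff[OF assms(1), of a b] by (auto simp: orientation_def)

text \<open>Finiteness and acyclicity make the converse of \<open>D\<close> well-founded on
  \<open>V\<close>, so some vertex of \<open>W\<close> has no arc into \<open>W\<close>. Any two
  vertices of a face span an edge, hence all others point to it.\<close>

lemma locally_acyclic_sink:
  assumes K: "geometric_complex K" and D: "locally_acyclic_orientation K D"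
    and V: "V \<in> vertex_scheme K" and W: "W \<subseteq> V" "W \<noteq> {}"
  shows "\<exists>m\<in>W. \<forall>a\<in>W. a \<noteq> m \<longrightarrow> (a, m) \<in> D"
proof -
  have ori: "orientation K D" using D by (simp add: locally_acyclic_orientation_def)
  obtain F where F: "F \<in> K" "V = vertices F" using V by (auto simp: vertex_scheme_def)
  have "acyclic (D \<inter> V \<times> V)" using D F by (auto simp: locally_acyclic_orientation_def)
  moreover have "finite (D \<inter> V \<times> V)" using scheme_hull(2)[OF K V] by auto
  ultimately have "wf ((D \<inter> V \<times> V)\<inverse>)" by (rule finite_acyclic_wf_converse[rotated])
  then obtain m where m: "m \<in> W" "\<And>y. (y, m) \<in> (D \<inter> V \<times> V)\<inverse> \<Longrightarrow> y \<notin> W"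
    using W(2) by (metis wfE_min')
  have "(a, m) \<in> D" if a: "a \<in> W" "a \<noteq> m" for a
  proof -
    have "(m, a) \<notin> D" using m a W by auto
    moreover have "{a, m} \<in> vertex_scheme K" using scheme_subset[OF K V, of "{a, m}"] a m W by auto
    ultimately show ?thesis using orientation_arc(2)[OF K ori] a by blast
  qed
  then show ?thesis using m(1) by blast
qed

text \<open>The sink of \<open>{a, b}\<close> orients each edge. The sink of
  \<open>Q \<inter> V\<close> has by antisymmetry no arc into \<open>Q\<close> within
  \<open>V\<close>, so it is minimal for the converse relation, which is therefore well-founded and
  acyclic.\<close>

lemma locally_acyclicI:
  assumes K: "geometric_complex K"
    and arc: "\<And>a b. (a, b) \<in> D \<Longrightarrow> a \<noteq> b \<and> {a, b} \<in> vertex_scheme K"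
    and anti: "\<And>a b. (a, b) \<in> D \<Longrightarrow> (b, a) \<notin> D"
    and sink: "\<And>W. W \<in> vertex_scheme K \<Longrightarrow> W \<noteq> {} \<Longrightarrow> \<exists>m\<in>W. \<forall>a\<in>W. a \<noteq> m \<longrightarrow> (a, m) \<in> D"
  shows "locally_acyclic_orientation K D"
proof -
  have "(a, b) \<in> D \<or> (b, a) \<in> D" if "a \<noteq> b" "{a, b} \<in> vertex_scheme K" for a b
    using sink[OF that(2)] that(1) by auto
  then have "orientation K D"
    unfolding orientation_def using arc anti in_edges_iff[OF K] by blast
  moreover have "acyclic (D \<inter> vertices F \<times> vertices F)" if F: "F \<in> K" for F
  proof -
    let ?V = "vertices F"
    have V: "?V \<in> vertex_scheme K" using F by (simp add: vertex_scheme_def)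
    have "wf ((D \<inter> ?V \<times> ?V)\<inverse>)"
    proof (rule wfI_min)
      fix x :: 'a and Q assume x: "x \<in> Q"
      show "\<exists>z\<in>Q. \<forall>y. (y, z) \<in> (D \<inter> ?V \<times> ?V)\<inverse> \<longrightarrow> y \<notin> Q"
      proof (cases "Q \<inter> ?V = {}")
        case True
        then show ?thesis using x by blast
      next
        case False
        moreover have "Q \<inter> ?V \<in> vertex_scheme K" using scheme_subset[OF K V] by blast
        ultimately obtain m where m: "m \<in> Q \<inter> ?V" "\<forall>a\<in>Q \<inter> ?V. a \<noteq> m \<longrightarrow> (a, m) \<in> D"
          using sink by blast
        then have "y \<notin> Q" if "(m, y) \<in> D" "y \<in> ?V" for y
          using anti[OF that(1)] that m by auto
        then show ?thesis using m(1) by blast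
      qed
    qed
    then show ?thesis using wf_acyclic acyclic_converse by blast
  qed
  ultimately show ?thesis by (auto simp: locally_acyclic_orientation_def)
qed

lemma staircase_subset:
  assumes "geometric_complex K" "S \<in> staircase_scheme (vertex_scheme K) D" "R \<subseteq> S"
  shows "R \<in> staircase_scheme (vertex_scheme K) D"
proof -
  have "fst ` R \<in> vertex_scheme K"
    using assms(2) scheme_subset[OF assms(1) _ image_mono[OF assms(3)]] by (auto simp: staircase_scheme_def)
  then show ?thesis using assms(2,3) by (auto simp: staircase_scheme_def)
qed

lemma staircase_in_prism:
  assumes "S \<in> staircase_scheme X D"
  shows "S \<subseteq> fst ` S \<times> {0, 1}" "convex hull S \<subseteq> (convex hull (fst ` S)) \<times> {0..1}"
proof -
  show S: "S \<subseteq> fst ` S \<times> {0, 1}"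
  proof
    fix p assume "p \<in> S"
    moreover from this have "p \<in> UNIV \<times> {0, 1}" using assms by (auto simp: staircase_scheme_def)
    ultimately show "p \<in> fst ` S \<times> {0, 1}" by (simp add: mem_Times_iff)
  qed
  have "convex hull S \<subseteq> convex hull (fst ` S \<times> {0, 1})" using S by (rule hull_mono)
  moreover have "convex hull {0, 1::real} = {0..1}"
    using segment_convex_hull[of "0::real" 1] by (simp add: closed_segment_eq_real_ivl)
  then have "convex hull (fst ` S \<times> {0, 1::real}) = (convex hull (fst ` S)) \<times> {0..1}"
    by (simp add: convex_hull_Times)
  ultimately show "convex hull S \<subseteq> (convex hull (fst ` S)) \<times> {0..1}" by simp
qed

text \<open>\<open>V\<close> may differ from the projection of \<open>S\<close>. Since coordinates
  of \<open>x\<close> in \<open>K\<close> are unique, all simplices over \<open>x\<close> can be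
  compared on the same \<open>V\<close> with the same \<open>l\<close>.\<close>

lemma staircase_bary:
  assumes K: "geometric_complex K" and S: "S \<in> staircase_scheme (vertex_scheme K) D"
    and w: "bary S w (x, t)" and V: "V \<in> vertex_scheme K" and l: "bary V l x"
  shows "l = (\<lambda>v. w (v, 0) + w (v, 1))" "(\<Sum>v\<in>V. w (v, 1)) = t"
    "\<And>p. 0 \<le> w p" "w (u, 0) \<noteq> 0 \<Longrightarrow> w (v, 1) \<noteq> 0 \<Longrightarrow> u = v \<or> (u, v) \<in> D"
proof -
  have W: "fst ` S \<in> vertex_scheme K" using S by (auto simp: staircase_scheme_def)
  have "S \<subseteq> fst ` S \<times> {0, 1}" using S by (rule staircase_in_prism)
  note * = bary_prism[OF scheme_hull(2)[OF K W] this, THEN iffD1, OF w]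
  show l_eq: "l = (\<lambda>v. w (v, 0) + w (v, 1))" using scheme_bary_unique[OF K V W l] * by blast
  show nonneg: "\<And>p. 0 \<le> w p" using * by blast
  have zero: "w (v, 1) = 0" if "v \<notin> V \<inter> fst ` S" for v
  proof -
    have "w (v, 0) + w (v, 1) = 0"
      using that l * l_eq unfolding bary_def by (metis IntI)
    then show ?thesis using nonneg[of "(v, 0)"] nonneg[of "(v, 1)"] by linarith
  qed
  \<comment> \<open>The upper weights live on the common part of \<open>V\<close> and the projection
    of \<open>S\<close>, so either may serve as index set.\<close>
  have "(\<Sum>v\<in>V. w (v, 1)) = (\<Sum>v\<in>V \<inter> fst ` S. w (v, 1))"
    using zero scheme_hull(2)[OF K V] by (intro sum.mono_neutral_right) auto
  also have "\<dots> = (\<Sum>v\<in>fst ` S. w (v, 1))"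
    using zero scheme_hull(2)[OF K W] by (intro sum.mono_neutral_left) auto
  finally show "(\<Sum>v\<in>V. w (v, 1)) = t" using * by simp
  show "u = v \<or> (u, v) \<in> D" if "w (u, 0) \<noteq> 0" "w (v, 1) \<noteq> 0"
  proof -
    have "(u, 0) \<in> S" "(v, 1) \<in> S" using that * by auto
    then show ?thesis using S by (auto simp: staircase_scheme_def)
  qed
qed

lemma bary_fst:
  assumes K: "geometric_complex K" and S: "S \<in> staircase_scheme (vertex_scheme K) D"
    and w: "bary S w (x, t)"
  obtains l where "bary (fst ` S) l x"
proof -
  have W: "fst ` S \<in> vertex_scheme K" using S by (auto simp: staircase_scheme_def)
  have "S \<subseteq> fst ` S \<times> {0, 1}" using S by (rule staircase_in_prism)
  then show ?thesis
    using that bary_prism[OF scheme_hull(2)[OF K W] , THEN iffD1, OF _ w] by blast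
qed

text \<open>Both weight functions split the same \<open>l\<close>, so
  \<open>distribution_unique\<close> identifies the upper weights, and subtraction the lower ones.
  Of \<open>D\<close> only antisymmetry is assumed; the arcs of a triangulation have it because
  diagonals cross.\<close>

lemma staircase_bary_unique:
  assumes K: "geometric_complex K"
    and anti: "\<And>u v. (u, v) \<in> D \<Longrightarrow> (v, u) \<notin> D"
    and S: "S \<in> staircase_scheme (vertex_scheme K) D" and w: "bary S w p"
    and S': "S' \<in> staircase_scheme (vertex_scheme K) D" and w': "bary S' w' p"
  shows "w = w'"
proof -
  obtain x t where p: "p = (x, t)" by (cases p)
  have V: "fst ` S \<in> vertex_scheme K" using S by (auto simp: staircase_scheme_def)
  obtain l where l: "bary (fst ` S) l x" using bary_fst[OF K S] w p by blast
  note b = staircase_bary[OF K S w[unfolded p] V l] and b' = staircase_bary[OF K S' w'[unfolded p] V l]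
  have eq: "w (v, 0) + w (v, 1) = w' (v, 0) + w' (v, 1)" for v
    using b(1) b'(1) by (metis (mono_tags))
  have upper: "w (v, 1) = w' (v, 1)" for v
  proof (cases "v \<in> fst ` S")
    case True
    show ?thesis
    proof (rule distribution_unique[where V = "fst ` S" and l = l and D = D])
      show "finite (fst ` S)" by (rule scheme_hull(2)[OF K V])
      show "(u, v) \<in> D" if "u \<noteq> v" "w (u, 1) < l u" "0 < w (v, 1)" for u v
        using b(4)[of u v] that b(1) by auto
      show "(u, v) \<in> D" if "u \<noteq> v" "w' (u, 1) < l u" "0 < w' (v, 1)" for u v
        using b'(4)[of u v] that b'(1) by auto
      show "w (v, 1) \<le> l v" for v using b(1) b(3)[of "(v, 0)"] by simp
      show "w' (v, 1) \<le> l v" for v using b'(1) b'(3)[of "(v, 0)"] by simp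
    qed (use anti b b' True in auto)
  next
    case False
    then have "l v = 0" using l by (auto simp: bary_def)
    then have "w (v, 0) + w (v, 1) = 0" using b(1) by simp
    then show ?thesis
      using eq[of v] b(3)[of "(v, 0)"] b(3)[of "(v, 1)"] b'(3)[of "(v, 0)"] b'(3)[of "(v, 1)"] by linarith
  qed
  have "w (v, i) = w' (v, i)" for v i
  proof -
    consider "i = 0" | "i = 1" | "(v, i) \<notin> S" "(v, i) \<notin> S'" using S S' by (auto simp: staircase_scheme_def)
    then show ?thesis
      by cases (use upper[of v] eq[of v] w w' in \<open>auto simp: bary_def\<close>)
  qed
  then show ?thesis by auto
qed

section \<open>The bijection\<close>

lemma bary_uniform:
  assumes "finite S" "S \<noteq> {}"
  shows "bary S (\<lambda>p. if p \<in> S then 1 / card S else 0) (\<Sum>p\<in>S. (1 / card S) *\<^sub>R p)"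
  using assms by (auto simp: bary_def intro!: sum.cong)

lemma bary_diagonal:
  obtains w where "bary {(u, 0), (v, 1 :: real)} w ((1 / 2) *\<^sub>R (u + v), 1 / 2)" "w (u, 0) \<noteq> 0"
proof
  show "bary {(u, 0), (v, 1 :: real)} (\<lambda>p. if p = (u, 0) \<or> p = (v, 1) then 1 / 2 else 0)
      ((1 / 2) *\<^sub>R (u + v), 1 / 2)"
    by (simp add: bary_def scaleR_add_right)
qed simp

lemma diagonals_cross:
  fixes u v :: "'a::euclidean_space"
  assumes "u \<noteq> v"
  obtains w w' p where "bary {(u, 0), (v, 1 :: real)} w p" "bary {(v, 0), (u, 1)} w' p" "w \<noteq> w'"
proof -
  obtain w where w: "bary {(u, 0), (v, 1 :: real)} w ((1 / 2) *\<^sub>R (u + v), 1 / 2)" "w (u, 0) \<noteq> 0"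
    by (rule bary_diagonal)
  obtain w' where w': "bary {(v, 0), (u, 1 :: real)} w' ((1 / 2) *\<^sub>R (v + u), 1 / 2)"
    by (rule bary_diagonal)
  have "w' (u, 0) = 0" using w' assms by (simp add: bary_def)
  then have "w \<noteq> w'" using w(2) by auto
  then show ?thesis using that w(1) w' by (simp add: add.commute)
qed

lemma triangulation_complex: "prism_triangulation A K T \<Longrightarrow> geometric_complex T"
  by (simp add: prism_triangulation_def)

lemma triangulation_diagonals_cross:
  assumes T: "geometric_complex T" and "(u, v) \<in> triangulation_arcs T"
  shows "(v, u) \<notin> triangulation_arcs T"
proof
  assume "(v, u) \<in> triangulation_arcs T"
  then have S: "{(u, 0), (v, 1)} \<in> vertex_scheme T" "{(v, 0), (u, 1)} \<in> vertex_scheme T" "u \<noteq> v"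
    using assms by (auto simp: triangulation_arcs_def)
  then show False
    using diagonals_cross[OF S(3)] scheme_bary_unique[OF T S(1,2)] by metis
qed

section \<open>The staircase triangulation of an orientation\<close>

context
  fixes A :: "'a::euclidean_space set" and K :: "'a set set"
  assumes finA: "finite A" and sub: "simplicial_subcomplex_of_faces A K"
begin

lemma K_complex: "geometric_complex K"
  using sub by (simp add: simplicial_subcomplex_of_faces_def)

lemma scheme_in_A: "V \<in> vertex_scheme K \<Longrightarrow> V \<subseteq> A \<and> convex hull V \<inter> A = V"
proof -
  assume V: "V \<in> vertex_scheme K"
  have "convex hull V \<inter> A = V"
    using scheme_hull(3,4)[OF K_complex V] sub by (simp add: simplicial_subcomplex_of_faces_def)
  then show ?thesis by auto
qed

lemma staircase_in_A:
  assumes "S \<in> staircase_scheme (vertex_scheme K) D"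
  shows "S \<subseteq> A \<times> {0, 1}" "finite S"
proof -
  have "fst ` S \<subseteq> A" using assms scheme_in_A by (auto simp: staircase_scheme_def)
  then show "S \<subseteq> A \<times> {0, 1}" using staircase_in_prism(1)[OF assms] by blast
  then show "finite S" using finA finite_subset by blast
qed

lemma finite_staircase: "finite (staircase_scheme (vertex_scheme K) D)"
proof (rule finite_subset)
  show "staircase_scheme (vertex_scheme K) D \<subseteq> Pow (A \<times> {0, 1})" using staircase_in_A(1) by blast
qed (use finA in simp)

lemma staircase_complex:
  assumes "locally_acyclic_orientation K D"
  shows "geometric_complex ((hull) convex ` staircase_scheme (vertex_scheme K) D)"
    "vertex_scheme ((hull) convex ` staircase_scheme (vertex_scheme K) D) = staircase_scheme (vertex_scheme K) D"
proof -
  have ori: "orientation K D" using assms by (simp add: locally_acyclic_orientation_def)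
  have anti: "\<And>u v. (u, v) \<in> D \<Longrightarrow> (v, u) \<notin> D" using orientation_arc[OF K_complex ori] by blast
  have emp: "{} \<in> staircase_scheme (vertex_scheme K) D"
    using empty_in_scheme[OF K_complex] by (auto simp: staircase_scheme_def)
  show "geometric_complex ((hull) convex ` staircase_scheme (vertex_scheme K) D)"
    by (rule geometric_complex_if_bary_unique(1)[OF finite_staircase staircase_in_A(2) emp
        staircase_subset[OF K_complex] staircase_bary_unique[OF K_complex anti]])
  show "vertex_scheme ((hull) convex ` staircase_scheme (vertex_scheme K) D) = staircase_scheme (vertex_scheme K) D"
    by (rule geometric_complex_if_bary_unique(2)[OF finite_staircase staircase_in_A(2) emp
        staircase_subset[OF K_complex] staircase_bary_unique[OF K_complex anti]])
qed

lemma staircase_triangulation: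
  assumes D: "locally_acyclic_orientation K D"
  shows "prism_triangulation A K ((hull) convex ` staircase_scheme (vertex_scheme K) D)"
  unfolding prism_triangulation_def
proof (intro conjI ballI)
  let ?X = "staircase_scheme (vertex_scheme K) D"
  show T: "geometric_complex ((hull) convex ` ?X)" by (rule staircase_complex[OF D])
  have inF: "\<exists>F\<in>K. convex hull S \<subseteq> F \<times> {0..1}" if "S \<in> ?X" for S
  proof
    show "convex hull (fst ` S) \<in> K"
      using that scheme_hull(3)[OF K_complex] unfolding staircase_scheme_def by blast
  qed (rule staircase_in_prism(2)[OF that])
  then show "\<exists>F\<in>K. S \<subseteq> F \<times> {0..1}" if "S \<in> (hull) convex ` ?X" for S using that by auto
  show "vertices S \<subseteq> A \<times> {0, 1}" if "S \<in> (hull) convex ` ?X" for S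
  proof -
    have "vertices S \<in> ?X" using that staircase_complex(2)[OF D] by (auto simp: vertex_scheme_def)
    then show ?thesis by (rule staircase_in_A)
  qed
  have "(x, t) \<in> \<Union> ((hull) convex ` ?X)" if F: "F \<in> K" "x \<in> F" and t: "0 \<le> t" "t \<le> 1" for x t F
  proof -
    have V: "vertices F \<in> vertex_scheme K" using F by (simp add: vertex_scheme_def)
    note fin = scheme_hull(2)[OF K_complex V]
    have "x \<in> convex hull vertices F" using complex_vertices[OF K_complex F(1)] F(2) by simp
    then obtain l where l: "bary (vertices F) l x" using ex_bary_iff[OF fin] by blast
    \<comment> \<open>Acyclicity is what makes the simplices cover the prism: every nonempty set of
      vertices of \<open>F\<close> has a sink, as the greedy distribution requires.\<close>
    have "\<exists>b. (\<forall>v\<in>vertices F. 0 \<le> b v \<and> b v \<le> l v) \<and> sum b (vertices F) = t \<and>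
      (\<forall>u\<in>vertices F. \<forall>v\<in>vertices F. u \<noteq> v \<longrightarrow> b u < l u \<longrightarrow> 0 < b v \<longrightarrow> (u, v) \<in> D)"
      using l t fin locally_acyclic_sink[OF K_complex D V]
      by (intro ex_distribution) (auto simp: bary_def)
    then obtain b where b: "\<forall>v\<in>vertices F. 0 \<le> b v \<and> b v \<le> l v" "sum b (vertices F) = t"
      "\<forall>u\<in>vertices F. \<forall>v\<in>vertices F. u \<noteq> v \<longrightarrow> b u < l u \<longrightarrow> 0 < b v \<longrightarrow> (u, v) \<in> D" by blast
    \<comment> \<open>The mass \<open>b\<close> goes to the upper layer and the rest to the lower
      one; the support of \<open>w\<close> is the simplex that will contain
      \<open>(x, t)\<close>.\<close>
    define w where "w = (\<lambda>(v, i). if v \<in> vertices F then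
      if i = 1 then b v else if i = (0::real) then l v - b v else 0 else 0)"
    have lw: "(\<lambda>v. w (v, 0) + w (v, 1)) = l"
      using l by (auto simp: w_def fun_eq_iff bary_def)
    have "bary (vertices F \<times> {0, 1}) w (x, t)"
      unfolding bary_prism[OF fin subset_refl] lw using b l by (auto simp: w_def cong: sum.cong)
    then have "bary {p. w p \<noteq> 0} w (x, t)" by (rule bary_support)
    then have "(x, t) \<in> convex hull {p. w p \<noteq> 0}" by (rule bary_imp_hull)
    moreover have "{p. w p \<noteq> 0} \<in> ?X"
    proof -
      have "fst ` {p. w p \<noteq> 0} \<subseteq> vertices F" by (auto simp: w_def split: if_splits)
      then have "fst ` {p. w p \<noteq> 0} \<in> vertex_scheme K" by (rule scheme_subset[OF K_complex V])
      \<comment> \<open>A lower weight means \<open>b u < l u\<close> and an upper weight means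
        \<open>0 < b v\<close>, exactly when the distribution supplies an arc.\<close>
      moreover have "u = v \<or> (u, v) \<in> D" if "w (u, 0) \<noteq> 0" "w (v, 1) \<noteq> 0" for u v
      proof -
        have "u \<in> vertices F" "v \<in> vertices F" "b u \<noteq> l u" "b v \<noteq> 0"
          using that by (auto simp: w_def split: if_splits)
        moreover from this have "b u < l u" "0 < b v" using b(1) by (simp_all add: less_le)
        ultimately show ?thesis using b(3) by blast
      qed
      moreover have "{p. w p \<noteq> 0} \<subseteq> UNIV \<times> {0, 1}" by (auto simp: w_def split: if_splits)
      ultimately show ?thesis unfolding staircase_scheme_def by blast
    qed
    ultimately show ?thesis by blast
  qed
  note cover = this
  show "\<Union> ((hull) convex ` ?X) = (\<Union>F\<in>K. F \<times> {0..1})"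
  proof (intro subset_antisym subsetI)
    fix p assume "p \<in> (\<Union>F\<in>K. F \<times> {0..1::real})"
    then obtain F where "F \<in> K" "fst p \<in> F" "0 \<le> snd p" "snd p \<le> 1" by auto
    then show "p \<in> \<Union> ((hull) convex ` ?X)" using cover[of F "fst p" "snd p"] by simp
  next
    fix p assume "p \<in> \<Union> ((hull) convex ` ?X)"
    then show "p \<in> (\<Union>F\<in>K. F \<times> {0..1})" using inF by blast
  qed
qed

lemma triangulation_arcs_staircase:
  assumes D: "locally_acyclic_orientation K D"
  shows "triangulation_arcs ((hull) convex ` staircase_scheme (vertex_scheme K) D) = D"
proof -
  have "orientation K D" using D by (simp add: locally_acyclic_orientation_def)
  note arc = orientation_arc(1)[OF K_complex this]
  show ?thesis
    unfolding triangulation_arcs_def staircase_complex(2)[OF D]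
    using arc by (auto simp: staircase_scheme_def)
qed

section \<open>Every triangulation is the staircase triangulation of its arcs\<close>

lemma triangulation_scheme_staircase:
  assumes T: "prism_triangulation A K T" and S: "S \<in> vertex_scheme T"
  shows "S \<in> staircase_scheme (vertex_scheme K) (triangulation_arcs T)"
proof -
  note K = K_complex
  have TC: "geometric_complex T" by (rule triangulation_complex[OF T])
  note hS = scheme_hull[OF TC S]
  obtain F where F: "F \<in> K" "convex hull S \<subseteq> F \<times> {0..1}"
    using T hS(3) by (auto simp: prism_triangulation_def)
  have SA: "S \<subseteq> A \<times> {0, 1}" using T hS(3,4) unfolding prism_triangulation_def by metis
  have "S \<subseteq> F \<times> {0..1}" using F(2) hull_subset[of S convex] by blast
  then have "fst ` S \<subseteq> F \<inter> A" using SA by auto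
  \<comment> \<open>Because \<open>F\<close> contains no point of \<open>A\<close> besides its
    vertices, the projection of \<open>S\<close> is a face of \<open>F\<close>.\<close>
  also have "F \<inter> A = vertices F" using sub F(1) by (auto simp: simplicial_subcomplex_of_faces_def)
  finally have "fst ` S \<in> vertex_scheme K"
    using scheme_subset[OF K, of "vertices F"] F(1) by (simp add: vertex_scheme_def)
  moreover have "a = b \<or> (a, b) \<in> triangulation_arcs T" if "(a, 0) \<in> S" "(b, 1) \<in> S" for a b
    using that scheme_subset[OF TC S, of "{(a, 0), (b, 1)}"] by (auto simp: triangulation_arcs_def)
  ultimately show ?thesis using SA by (auto simp: staircase_scheme_def)
qed

lemma triangulation_bary:
  assumes T: "prism_triangulation A K T" and p: "x \<in> convex hull V" "V \<in> vertex_scheme K" "0 \<le> t" "t \<le> 1"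
  obtains S w where "S \<in> vertex_scheme T" "bary S w (x, t)"
proof -
  have TC: "geometric_complex T" by (rule triangulation_complex[OF T])
  have "(x, t) \<in> (convex hull V) \<times> {0..1}" "convex hull V \<in> K"
    using p scheme_hull(3)[OF K_complex] by auto
  then have "(x, t) \<in> \<Union> T" using T by (auto simp: prism_triangulation_def)
  then obtain G where G: "G \<in> T" "(x, t) \<in> G" by blast
  then have "(x, t) \<in> convex hull (vertices G)" using complex_vertices(3)[OF TC] by simp
  then obtain w where "bary (vertices G) w (x, t)"
    using ex_bary_iff[OF complex_vertices(2)[OF TC G(1)]] by blast
  then show ?thesis using that G(1) by (auto simp: vertex_scheme_def)
qed

text \<open>The sink of \<open>W\<close> is found just above the barycentre of \<open>W\<close>.\<close>

lemma triangulation_sink: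
  assumes T: "prism_triangulation A K T" and W: "W \<in> vertex_scheme K" "W \<noteq> {}"
  shows "\<exists>m\<in>W. \<forall>a\<in>W. a \<noteq> m \<longrightarrow> (a, m) \<in> triangulation_arcs T"
proof -
  note K = K_complex
  note fin = scheme_hull(2)[OF K W(1)]
  define l where "l = (\<lambda>v. if v \<in> W then 1 / card W else 0)"
  define x where "x = (\<Sum>v\<in>W. (1 / card W) *\<^sub>R v)"
  \<comment> \<open>Half the weight of one vertex: positive, so some \<open>m\<close> carries upper
    weight, but below \<open>1 / card W\<close>, so every vertex of \<open>W\<close> keeps some
    lower weight.\<close>
  define t where "t = 1 / (2 * real (card W))"
  have card: "1 \<le> real (card W)" using fin W(2) by (simp add: Suc_le_eq card_gt_0_iff)
  have t: "0 < t" "t \<le> 1" "t < 1 / card W" using card by (auto simp: t_def divide_simps)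
  have l: "bary W l x" unfolding l_def x_def by (rule bary_uniform[OF fin W(2)])
  obtain S w where S: "S \<in> vertex_scheme T" and w: "bary S w (x, t)"
    using triangulation_bary[OF T bary_imp_hull[OF l] W(1), of t] t less_imp_le by blast
  note b = staircase_bary[OF K triangulation_scheme_staircase[OF T S] w W(1) l]
  have "(\<Sum>v\<in>W. w (v, 1)) \<noteq> 0" using b(2) t(1) by linarith
  then obtain m where m: "m \<in> W" "w (m, 1) \<noteq> 0" by (rule sum.not_neutral_contains_not_neutral)
  have "(a, m) \<in> triangulation_arcs T" if a: "a \<in> W" "a \<noteq> m" for a
  proof -
    have "w (a, 1) \<le> t"
      using member_le_sum[OF a(1), of "\<lambda>v. w (v, 1)"] b(2,3) fin by simp
    moreover have "w (a, 0) + w (a, 1) = 1 / card W" using fun_cong[OF b(1), of a] a by (simp add: l_def)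
    ultimately have "w (a, 0) \<noteq> 0" using t(3) by linarith
    then show ?thesis using b(4) m(2) a(2) by blast
  qed
  then show ?thesis using m(1) by blast
qed

lemma triangulation_arcs_locally_acyclic:
  assumes T: "prism_triangulation A K T"
  shows "locally_acyclic_orientation K (triangulation_arcs T)"
proof (rule locally_acyclicI[OF K_complex])
  fix a b assume ab: "(a, b) \<in> triangulation_arcs T"
  then have "{(a, 0), (b, 1)} \<in> staircase_scheme (vertex_scheme K) (triangulation_arcs T)"
    using triangulation_scheme_staircase[OF T] by (auto simp: triangulation_arcs_def)
  then show "a \<noteq> b \<and> {a, b} \<in> vertex_scheme K"
    using ab by (auto simp: triangulation_arcs_def staircase_scheme_def)
  show "(b, a) \<notin> triangulation_arcs T"
    by (rule triangulation_diagonals_cross[OF triangulation_complex[OF T] ab])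
qed (rule triangulation_sink[OF T])

text \<open>The barycentre of a staircase set \<open>S\<close> lies in some simplex
  \<open>S'\<close> of \<open>T\<close>, which is itself a staircase set for the same arcs.
  Uniqueness of weights, all positive on \<open>S\<close>, gives
  \<open>S \<subseteq> S'\<close>.\<close>

lemma triangulation_scheme:
  assumes T: "prism_triangulation A K T"
  shows "vertex_scheme T = staircase_scheme (vertex_scheme K) (triangulation_arcs T)"
proof (intro subset_antisym subsetI)
  note K = K_complex
  have TC: "geometric_complex T" by (rule triangulation_complex[OF T])
  fix S assume S: "S \<in> staircase_scheme (vertex_scheme K) (triangulation_arcs T)"
  show "S \<in> vertex_scheme T"
  proof (cases "S = {}")
    case True
    then show ?thesis using empty_in_scheme[OF TC] by simp
  next
    case False
    define w where "w = (\<lambda>p. if p \<in> S then 1 / real (card S) else 0)"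
    have fin: "finite S" by (rule staircase_in_A(2)[OF S])
    then obtain x t where w: "bary S w (x, t)"
      using bary_uniform[OF _ False] unfolding w_def by (metis surj_pair)
    then have "(x, t) \<in> (convex hull (fst ` S)) \<times> {0..1}"
      using staircase_in_prism(2)[OF S] bary_imp_hull by blast
    moreover have "fst ` S \<in> vertex_scheme K" using S by (auto simp: staircase_scheme_def)
    ultimately obtain S' w' where S': "S' \<in> vertex_scheme T" and w': "bary S' w' (x, t)"
      using triangulation_bary[OF T, of x "fst ` S" t] by auto
    have "w = w'"
      by (rule staircase_bary_unique[OF K triangulation_diagonals_cross[OF TC] S w
            triangulation_scheme_staircase[OF T S'] w'])
    have "S \<subseteq> S'"
    proof
      fix p assume "p \<in> S"
      then have "w p \<noteq> 0" using fin by (auto simp: w_def)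
      then show "p \<in> S'" using bary_pos[OF w'] \<open>w = w'\<close> by simp
    qed
    then show ?thesis by (rule scheme_subset[OF TC S'])
  qed
qed (rule triangulation_scheme_staircase[OF T])

lemma bij_betw_triangulation_arcs:
  "bij_betw triangulation_arcs {T. prism_triangulation A K T} {D. locally_acyclic_orientation K D}"
proof (rule bij_betw_byWitness[where f' = "\<lambda>D. (hull) convex ` staircase_scheme (vertex_scheme K) D"])
  show "\<forall>T\<in>{T. prism_triangulation A K T}.
      (hull) convex ` staircase_scheme (vertex_scheme K) (triangulation_arcs T) = T"
    using triangulation_scheme complex_eq_hulls triangulation_complex by (metis mem_Collect_eq)
qed (use triangulation_arcs_staircase triangulation_arcs_locally_acyclic
      staircase_triangulation in auto)

end

section \<open>Flips\<close>

lemma square_affine_dependent: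
  fixes u v :: "'a::euclidean_space"
  assumes "u \<noteq> v"
  shows "affine_dependent ({u, v} \<times> {0, 1 :: real})"
proof (rule ccontr)
  assume ind: "\<not> affine_dependent ({u, v} \<times> {0, 1 :: real})"
  obtain w w' p where w: "bary {(u, 0), (v, 1 :: real)} w p" "bary {(v, 0), (u, 1)} w' p" "w \<noteq> w'"
    by (rule diagonals_cross[OF assms])
  have "bary ({u, v} \<times> {0, 1}) w p" "bary ({u, v} \<times> {0, 1}) w' p"
    by (rule bary_extend[OF w(1)] bary_extend[OF w(2)]; simp)+
  then show False using bary_unique[OF ind] w(3) by blast
qed

text \<open>Both parts of the circuit project to faces of \<open>K\<close>, so a common point has the same barycentric
  coordinates below; the two ways of distributing them over the layers differ at two vertices
  with opposite signs.\<close>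

lemma staircase_circuit:
  assumes K: "geometric_complex K" and Z: "circuit_partition Z Zp Zm"
    and Zp: "Zp \<in> staircase_scheme (vertex_scheme K) D'" and Zm: "Zm \<in> staircase_scheme (vertex_scheme K) D"
    and fin: "finite Zp" "finite Zm"
  obtains u v where "u \<noteq> v" "Z = {u, v} \<times> {0, 1}" "Zm = {(u, 0), (v, 1)}" "Zp = {(v, 0), (u, 1)}"
proof -
  have mad: "minimal_affine_dependent Z" and Zun: "Z = Zp \<union> Zm" and disj: "Zp \<inter> Zm = {}"
    and "convex hull Zp \<inter> convex hull Zm \<noteq> {}"
    using Z by (auto simp: circuit_partition_def)
  then obtain x t where "(x, t) \<in> convex hull Zp" "(x, t) \<in> convex hull Zm" by auto
  then obtain w w' where w: "bary Zp w (x, t)" and w': "bary Zm w' (x, t)"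
    using ex_bary_iff fin by metis
  obtain l where l: "bary (fst ` Zp) l x" using bary_fst[OF K Zp w] by blast
  have V: "fst ` Zp \<in> vertex_scheme K" using Zp by (auto simp: staircase_scheme_def)
  note b = staircase_bary[OF K Zp w V l] and b' = staircase_bary[OF K Zm w' V l]
  have eq: "w (v, 0) + w (v, 1) = w' (v, 0) + w' (v, 1)" for v
    using b(1) b'(1) by (metis (mono_tags))
  have in_part: "w p \<noteq> 0 \<Longrightarrow> p \<in> Zp" "w' p \<noteq> 0 \<Longrightarrow> p \<in> Zm" for p
    using bary_pos[OF w] bary_pos[OF w'] by blast+
  obtain q i where q: "(q, i) \<in> Zp" "w (q, i) \<noteq> 0"
    using w unfolding bary_def by (metis sum.neutral surj_pair zero_neq_one)
  then have "w' (q, i) = 0" using in_part(2) disj by blast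
  moreover have "i = 0 \<or> i = 1" using q(1) Zp by (auto simp: staircase_scheme_def)
  \<comment> \<open>For \<open>i = 1\<close> this is immediate; for \<open>i = 0\<close> the equal
    fibre sums carry the difference to the upper layer.\<close>
  ultimately have "w (q, 1) \<noteq> w' (q, 1)" using q(2) eq[of q] by auto
  moreover have "q \<in> fst ` Zp" using q(1) by force
  ultimately have ne: "\<exists>q\<in>fst ` Zp. w (q, 1) \<noteq> w' (q, 1)" by blast
  \<comment> \<open>The upper weights differ somewhere but have equal sums, so the difference takes
    both signs.\<close>
  have "\<exists>v. w' (v, 1) < w (v, 1)"
  proof (rule ccontr)
    assume "\<not> ?thesis"
    then have le: "w (v, 1) \<le> w' (v, 1)" for v by (simp add: not_less)
    moreover have "\<exists>v\<in>fst ` Zp. w (v, 1) < w' (v, 1)"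
      using ne le unfolding less_le by metis
    ultimately have "(\<Sum>v\<in>fst ` Zp. w (v, 1)) < (\<Sum>v\<in>fst ` Zp. w' (v, 1))"
      using fin(1) by (intro sum_strict_mono_ex1) auto
    then show False using b(2) b'(2) by simp
  qed
  then obtain u where u: "w' (u, 1) < w (u, 1)" by blast
  have "\<exists>v. w (v, 1) < w' (v, 1)"
  proof (rule ccontr)
    assume "\<not> ?thesis"
    then have le: "w' (v, 1) \<le> w (v, 1)" for v by (simp add: not_less)
    moreover have "\<exists>v\<in>fst ` Zp. w' (v, 1) < w (v, 1)"
      using ne le unfolding less_le by metis
    ultimately have "(\<Sum>v\<in>fst ` Zp. w' (v, 1)) < (\<Sum>v\<in>fst ` Zp. w (v, 1))"
      using fin(1) by (intro sum_strict_mono_ex1) auto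
    then show False using b(2) b'(2) by simp
  qed
  then obtain v where v: "w (v, 1) < w' (v, 1)" by blast
  have "u \<noteq> v" using u v by auto
  \<comment> \<open>More upper weight in \<open>w\<close> than in \<open>w'\<close> means less lower
    weight, so \<open>w\<close> is positive above \<open>u\<close> and \<open>w'\<close> below it.
    At \<open>v\<close> the roles are exchanged.\<close>
  have "w (u, 1) \<noteq> 0" "w' (u, 0) \<noteq> 0" using u b(3)[of "(u, 0)"] b'(3)[of "(u, 1)"] eq[of u] by linarith+
  then have Zu: "(u, 1) \<in> Zp" "(u, 0) \<in> Zm" using in_part by auto
  have "w' (v, 1) \<noteq> 0" "w (v, 0) \<noteq> 0" using v b'(3)[of "(v, 0)"] b(3)[of "(v, 1)"] eq[of v] by linarith+
  then have Zv: "(v, 1) \<in> Zm" "(v, 0) \<in> Zp" using in_part by auto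
  have "{u, v} \<times> {0, 1} \<subseteq> Z" using Zu Zv Zun by auto
  \<comment> \<open>The square is already dependent, so a minimal dependent set containing it equals
    it.\<close>
  then have Zeq: "Z = {u, v} \<times> {0, 1}"
    using mad square_affine_dependent[OF \<open>u \<noteq> v\<close>] unfolding minimal_affine_dependent_def by blast
  moreover have "Zm = {(u, 0), (v, 1)}" "Zp = {(v, 0), (u, 1)}"
  proof -
    have "Zm \<subseteq> {u, v} \<times> {0, 1}" "Zp \<subseteq> {u, v} \<times> {0, 1}" using Zun Zeq by blast+
    then show "Zm = {(u, 0), (v, 1)}" "Zp = {(v, 0), (u, 1)}" using Zu Zv disj by blast+
  qed
  ultimately show ?thesis using that \<open>u \<noteq> v\<close> by blast
qed

lemma complex_join_empty_right: "{} \<in> L \<Longrightarrow> C \<subseteq> complex_join C L"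
  by (auto simp: complex_join_def)

lemma maximal_subsets_avoiding:
  "maximal_simplices (subsets_avoiding Z Y) = {Z - {z} |z. z \<in> Y}" if "Y \<subseteq> Z"
proof (intro subset_antisym subsetI)
  fix M assume M: "M \<in> maximal_simplices (subsets_avoiding Z Y)"
  then obtain z where z: "z \<in> Y" "z \<notin> M" "M \<subseteq> Z"
    by (auto simp: maximal_simplices_def subsets_avoiding_def)
  then have "Z - {z} \<in> subsets_avoiding Z Y" by (auto simp: subsets_avoiding_def)
  moreover have "M \<subseteq> Z - {z}" using z by blast
  moreover have "\<forall>R\<in>subsets_avoiding Z Y. M \<subseteq> R \<longrightarrow> R = M"
    using M by (simp add: maximal_simplices_def)
  ultimately have "M = Z - {z}" by metis
  then show "M \<in> {Z - {z} |z. z \<in> Y}" using z by blast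
next
  fix M assume "M \<in> {Z - {z} |z. z \<in> Y}"
  then show "M \<in> maximal_simplices (subsets_avoiding Z Y)"
    using that by (auto simp: maximal_simplices_def subsets_avoiding_def)
qed

section \<open>From flips to arc reversals\<close>

lemma flip_imp_reversal:
  assumes K: "geometric_complex K"
    and D: "orientation K D" "vertex_scheme T = staircase_scheme (vertex_scheme K) D"
    and D': "orientation K D'" "vertex_scheme T' = staircase_scheme (vertex_scheme K) D'"
    and fin: "\<And>S D. S \<in> staircase_scheme (vertex_scheme K) D \<Longrightarrow> finite S"
    and flip: "flip P T T'"
  shows "single_edge_reversal D D'"
proof -
  obtain Z Zp Zm L where Z: "circuit_partition Z Zp Zm"
    and sub: "subsets_avoiding Z Zp \<subseteq> vertex_scheme T"
    and link: "\<forall>M \<in> maximal_simplices (subsets_avoiding Z Zp). simplex_link (vertex_scheme T) M = L"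
    and T': "vertex_scheme T' = (vertex_scheme T - complex_join (subsets_avoiding Z Zp) L)
      \<union> complex_join (subsets_avoiding Z Zm) L"
    using flip by (auto simp: flip_def)
  have part: "Z = Zp \<union> Zm" "Zp \<inter> Zm = {}" "Zp \<noteq> {}" "Zm \<noteq> {}"
    using Z by (auto simp: circuit_partition_def)
  obtain z where z: "z \<in> Zp" using part by blast
  then have "Z - {z} \<in> maximal_simplices (subsets_avoiding Z Zp)"
    using maximal_subsets_avoiding[of Zp Z] part(1) by blast
  moreover from this have "Z - {z} \<in> vertex_scheme T" using sub by (auto simp: maximal_simplices_def)
  \<comment> \<open>The link contains the empty simplex, so all of \<open>T\<^sub>-(Z)\<close> lies
    in the new scheme.\<close>
  ultimately have "{} \<in> L"
    using link staircase_subset[OF K, of "Z - {z}" D "{}"] D(2) by (auto simp: simplex_link_def)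
  then have sub': "subsets_avoiding Z Zm \<subseteq> vertex_scheme T'"
    unfolding T' using complex_join_empty_right by blast
  \<comment> \<open>As the parts are disjoint and nonempty, \<open>Zm\<close> belongs to
    \<open>T\<^sub>+(Z)\<close> and \<open>Zp\<close> to \<open>T\<^sub>-(Z)\<close>: the old and
    the new diagonal.\<close>
  have Zm: "Zm \<in> staircase_scheme (vertex_scheme K) D"
    using sub part unfolding D(2) subsets_avoiding_def by blast
  have Zp: "Zp \<in> staircase_scheme (vertex_scheme K) D'"
    using sub' part unfolding D'(2) subsets_avoiding_def by blast
  obtain u v where uv: "u \<noteq> v" "Zm = {(u, 0), (v, 1)}" "Zp = {(v, 0), (u, 1)}"
    using staircase_circuit[OF K Z Zp Zm fin[OF Zp] fin[OF Zm]] by metis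
  have arc: "(u, v) \<in> D" "(v, u) \<in> D'"
    using Zm Zp uv by (auto simp: staircase_scheme_def)
  have keep: "(a, b) \<in> D'" if ab: "(a, b) \<in> D" "(a, b) \<noteq> (u, v)" for a b
  proof -
    note a = orientation_arc(1)[OF K D(1) ab(1)]
    have E: "{(a, 0), (b, 1)} \<in> vertex_scheme T"
      using ab(1) a unfolding D(2) by (auto simp: staircase_scheme_def)
    have "{(a, 0), (b, 1)} \<in> vertex_scheme T'"
    proof (cases "{(a, 0), (b, 1)} \<in> complex_join (subsets_avoiding Z Zp) L")
      case True
      then obtain S R where S: "{(a, 0), (b, 1)} = S \<union> R" "S \<subseteq> Z" "R \<in> L"
        by (auto simp: complex_join_def subsets_avoiding_def)
      \<comment> \<open>A diagonal other than \<open>Zm\<close> that the flip deletes is restored at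
        once, since its part in \<open>Z\<close> also avoids \<open>Zm\<close>.\<close>
      have "\<not> Zm \<subseteq> {(a, 0), (b, 1)}" using ab(2) uv by auto
      then have "S \<in> subsets_avoiding Z Zm" using S by (auto simp: subsets_avoiding_def)
      then have "S \<union> R \<in> vertex_scheme T'" unfolding T' complex_join_def using S(3) by blast
      then show ?thesis using S(1) by simp
    next
      case False
      then show ?thesis using E T' by blast
    qed
    then show ?thesis unfolding D'(2) using a by (auto simp: staircase_scheme_def)
  qed
  \<comment> \<open>No second argument about joins is needed: a new arc absent from \<open>D\<close>
    has its reverse in \<open>D\<close>, and that reverse would have been kept.\<close>
  have "(a, b) \<in> D" if ab: "(a, b) \<in> D'" "(a, b) \<noteq> (v, u)" for a b
  proof (rule ccontr)
    assume "(a, b) \<notin> D"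
    note a = orientation_arc(1)[OF K D'(1) ab(1)]
    have "(b, a) \<in> D" using orientation_arc(2)[OF K D(1)] a \<open>(a, b) \<notin> D\<close> by blast
    then have "(b, a) \<in> D'" using keep ab(2) by blast
    then show False using orientation_arc(2)[OF K D'(1)] a ab(1) by blast
  qed
  moreover have "(u, v) \<notin> D'" using orientation_arc[OF K D'(1)] arc(2) by metis
  ultimately have "D' = insert (v, u) (D - {(u, v)})"
    using keep arc by auto
  then show ?thesis using arc(1) unfolding single_edge_reversal_def by blast
qed

section \<open>From arc reversals to flips\<close>

lemma locally_acyclic_trans:
  assumes K: "geometric_complex K" and D: "locally_acyclic_orientation K D"
    and V: "{a, b, c} \<in> vertex_scheme K" and arcs: "(a, b) \<in> D" "(b, c) \<in> D"
  shows "(a, c) \<in> D"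
proof -
  have ori: "orientation K D" using D by (simp add: locally_acyclic_orientation_def)
  note anti = orientation_arc[OF K ori]
  have "(b, a) \<notin> D" "(c, b) \<notin> D" "a \<noteq> b" "b \<noteq> c" using anti arcs by metis+
  moreover have "a \<noteq> c" using anti arcs by metis
  \<comment> \<open>Both \<open>a\<close> and \<open>b\<close> have outgoing arcs, so the sink of
    the triangle is \<open>c\<close>.\<close>
  moreover obtain m where "m \<in> {a, b, c}" "\<forall>x\<in>{a, b, c}. x \<noteq> m \<longrightarrow> (x, m) \<in> D"
    using locally_acyclic_sink[OF K D V] by blast
  ultimately show ?thesis by auto
qed

text \<open>The expected common link, in explicit form: lower vertices precede both \<open>u\<close>
  and \<open>v\<close>, upper vertices follow both. The form is symmetric in \<open>u\<close> and
  \<open>v\<close>, so it serves before and after the flip.\<close>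

definition square_link :: "'a set set \<Rightarrow> ('a \<times> 'a) set \<Rightarrow> 'a \<Rightarrow> 'a \<Rightarrow> ('a \<times> real) set set" where
  "square_link X D u v = {R. R \<subseteq> UNIV \<times> {0, 1} \<and> R \<inter> ({u, v} \<times> {0, 1}) = {} \<and> fst ` R \<union> {u, v} \<in> X \<and>
     (\<forall>a b. (a, 0) \<in> R \<longrightarrow> (b, 1) \<in> R \<longrightarrow> a = b \<or> (a, b) \<in> D) \<and>
     (\<forall>a. (a, 0) \<in> R \<longrightarrow> (a, u) \<in> D \<and> (a, v) \<in> D) \<and>
     (\<forall>b. (b, 1) \<in> R \<longrightarrow> (u, b) \<in> D \<and> (v, b) \<in> D)}"

text \<open>The hypotheses are symmetric under exchanging \<open>D\<close> with \<open>D'\<close>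
  and \<open>u\<close> with \<open>v\<close>, so each fact about the old scheme also yields its
  mirror image for the new one.\<close>

locale edge_reversal =
  fixes K :: "'a::euclidean_space set set" and D D' :: "('a \<times> 'a) set" and u v :: 'a
  assumes K: "geometric_complex K"
    and D: "locally_acyclic_orientation K D" and D': "locally_acyclic_orientation K D'"
    and arc: "(u, v) \<in> D" and reversed: "D' = insert (v, u) (D - {(u, v)})"
begin

abbreviation "X \<equiv> staircase_scheme (vertex_scheme K) D"
abbreviation "X' \<equiv> staircase_scheme (vertex_scheme K) D'"
abbreviation "Z \<equiv> {u, v} \<times> {0, 1 :: real}"
abbreviation "L \<equiv> square_link (vertex_scheme K) D u v"

lemma orientations: "orientation K D" "orientation K D'"
  using D D' by (simp_all add: locally_acyclic_orientation_def)

lemma uv: "u \<noteq> v" "{u, v} \<in> vertex_scheme K" "(v, u) \<notin> D"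
  using orientation_arc[OF K orientations(1)] arc by metis+

lemma reverse: "edge_reversal K D' D v u"
  using K D D' arc uv reversed by unfold_locales auto

text \<open>Members of the link avoid the square, so only arcs with an endpoint outside
  \<open>{u, v}\<close> are tested, and on these \<open>D\<close> and \<open>D'\<close>
  agree.\<close>

lemma reverse_link: "square_link (vertex_scheme K) D' v u = L"
proof -
  have eq: "(a, b) \<in> D' \<longleftrightarrow> (a, b) \<in> D" if "a \<notin> {u, v} \<or> b \<notin> {u, v}" for a b
    using that reversed by auto
  have "(a, b) \<in> D' \<longleftrightarrow> (a, b) \<in> D" "(b, a) \<in> D' \<longleftrightarrow> (b, a) \<in> D"
    if "(a, i) \<in> R" "R \<subseteq> UNIV \<times> {0, 1 :: real}" "R \<inter> Z = {}" for a b R i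
  proof -
    have "a \<notin> {u, v}" using that by blast
    then show "(a, b) \<in> D' \<longleftrightarrow> (a, b) \<in> D" "(b, a) \<in> D' \<longleftrightarrow> (b, a) \<in> D" using eq by blast+
  qed
  then show ?thesis
    unfolding square_link_def insert_commute[of v u] by (intro Collect_cong) (smt (verit))
qed

text \<open>No vertex of a common face lies between \<open>u\<close> and \<open>v\<close>: a path u
  -> a -> v would close to a cycle after the reversal. One direction uses transitivity of
  \<open>D\<close> through u -> v, the other that of \<open>D'\<close> through v -> u.\<close>

lemma same_position:
  assumes "{a, u, v} \<in> vertex_scheme K" "a \<noteq> u" "a \<noteq> v"
  shows "(a, u) \<in> D \<longleftrightarrow> (a, v) \<in> D" "(u, a) \<in> D \<longleftrightarrow> (v, a) \<in> D"
proof -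
  show *: "(a, u) \<in> D \<longleftrightarrow> (a, v) \<in> D"
  proof
    assume "(a, u) \<in> D"
    then show "(a, v) \<in> D" using locally_acyclic_trans[OF K D assms(1)] arc by blast
  next
    assume "(a, v) \<in> D"
    then have "(a, v) \<in> D'" "(v, u) \<in> D'" using assms reversed by auto
    moreover have "{a, v, u} \<in> vertex_scheme K" using assms(1) by (simp add: insert_commute)
    ultimately have "(a, u) \<in> D'" using locally_acyclic_trans[OF K D'] by blast
    then show "(a, u) \<in> D" using assms reversed by auto
  qed
  have "{a, u} \<in> vertex_scheme K" "{a, v} \<in> vertex_scheme K"
    using scheme_subset[OF K assms(1)] by auto
  then show "(u, a) \<in> D \<longleftrightarrow> (v, a) \<in> D"
    using * orientation_arc(2)[OF K orientations(1)] assms(2,3) by metis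
qed

text \<open>The diagonal in \<open>M\<close> forces a -> v for lower \<open>a\<close> and u -> b for
  upper \<open>b\<close>, and \<open>same_position\<close> supplies the other two arcs. The
  condition on \<open>R\<close> is therefore the same for every such \<open>M\<close>.\<close>

lemma square_link_iff:
  assumes M: "M \<subseteq> Z" "{(u, 0), (v, 1)} \<subseteq> M" "\<not> {(v, 0), (u, 1)} \<subseteq> M" and R: "R \<inter> Z = {}"
  shows "R \<union> M \<in> X \<longleftrightarrow> R \<in> L"
proof -
  have "fst ` M = {u, v}"
  proof
    show "fst ` M \<subseteq> {u, v}" using M(1) by auto
    show "{u, v} \<subseteq> fst ` M" using image_mono[OF M(2), of fst] by simp
  qed
  then have fst: "fst ` (R \<union> M) = fst ` R \<union> {u, v}" by (simp add: image_Un)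
  show ?thesis
  proof
    assume RM: "R \<union> M \<in> X"
    then have VR: "fst ` R \<union> {u, v} \<in> vertex_scheme K" and R01: "R \<subseteq> UNIV \<times> {0, 1}"
      unfolding staircase_scheme_def mem_Collect_eq fst by blast+
    have pos: "{a, u, v} \<in> vertex_scheme K" "a \<noteq> u" "a \<noteq> v" if "(a, i) \<in> R" for a i
    proof -
      have "a \<in> fst ` R" using that by force
      then show "{a, u, v} \<in> vertex_scheme K" using scheme_subset[OF K VR, of "{a, u, v}"] by auto
      show "a \<noteq> u" "a \<noteq> v" using that R R01 by blast+
    qed
    have "(a, u) \<in> D \<and> (a, v) \<in> D" if a: "(a, 0) \<in> R" for a
    proof -
      have "(a, v) \<in> D" using RM M(2) a pos(3)[OF a] by (auto simp: staircase_scheme_def)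
      then show ?thesis using same_position(1)[OF pos[OF a]] by blast
    qed
    moreover have "(u, b) \<in> D \<and> (v, b) \<in> D" if b: "(b, 1) \<in> R" for b
    proof -
      have "(u, b) \<in> D" using RM M(2) b pos(2)[OF b] by (auto simp: staircase_scheme_def)
      then show ?thesis using same_position(2)[OF pos[OF b]] by blast
    qed
    ultimately show "R \<in> L"
      using VR R01 R RM unfolding square_link_def staircase_scheme_def by blast
  next
    assume RL: "R \<in> L"
    have RR: "a = b \<or> (a, b) \<in> D" if "(a, 0) \<in> R" "(b, 1) \<in> R" for a b
      using RL that unfolding square_link_def by blast
    have Ruv: "(a, u) \<in> D \<and> (a, v) \<in> D" if "(a, 0) \<in> R" for a
      using RL that unfolding square_link_def by blast
    have uvR: "(u, b) \<in> D \<and> (v, b) \<in> D" if "(b, 1) \<in> R" for b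
      using RL that unfolding square_link_def by blast
    have "a = b \<or> (a, b) \<in> D" if ab: "(a, 0) \<in> R \<union> M" "(b, 1) \<in> R \<union> M" for a b
    proof -
      have inM: "x \<in> {u, v}" if "(x, i) \<in> M" for x i using that M(1) by auto
      consider "(a, 0) \<in> R" "(b, 1) \<in> R" | "(a, 0) \<in> R" "(b, 1) \<in> M"
        | "(a, 0) \<in> M" "(b, 1) \<in> R" | "(a, 0) \<in> M" "(b, 1) \<in> M" using ab by blast
      then show ?thesis
      proof cases
        case 1
        then show ?thesis by (rule RR)
      next
        case 2
        then show ?thesis using Ruv[OF 2(1)] inM[OF 2(2)] by blast
      next
        case 3
        then show ?thesis using uvR[OF 3(2)] inM[OF 3(1)] by blast
      next
        case 4
        then have "\<not> (a = v \<and> b = u)" using M(3) by blast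
        then show ?thesis using inM[OF 4(1)] inM[OF 4(2)] arc by blast
      qed
    qed
    then show "R \<union> M \<in> X"
      using RL M(1) fst unfolding staircase_scheme_def square_link_def by auto
  qed
qed

lemma empty_in_link: "{} \<in> L"
  using uv by (simp add: square_link_def)

lemma not_reversed_diagonal: "S \<in> X \<Longrightarrow> \<not> {(v, 0), (u, 1)} \<subseteq> S"
  using uv by (auto simp: staircase_scheme_def)

lemma join_subset: "complex_join (subsets_avoiding Z {(v, 0), (u, 1)}) L \<subseteq> X"
proof
  fix S assume "S \<in> complex_join (subsets_avoiding Z {(v, 0), (u, 1)}) L"
  then obtain M R where S: "S = M \<union> R" "M \<subseteq> Z" "\<not> {(v, 0), (u, 1)} \<subseteq> M" "R \<in> L"
    by (auto simp: complex_join_def subsets_avoiding_def)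
  \<comment> \<open>\<open>M\<close> may lack the diagonal, so it is enlarged first;
    \<open>S\<close> is then a subset of a simplex.\<close>
  have "R \<union> (M \<union> {(u, 0), (v, 1)}) \<in> X"
    using S uv(1) by (subst square_link_iff) (auto simp: square_link_def)
  then show "S \<in> X" by (rule staircase_subset[OF K]) (use S in auto)
qed

text \<open>Ensures that the flip deletes every simplex through the old diagonal: such a simplex
  splits into its part in the square and a member of the link.\<close>

lemma diagonal_in_join:
  assumes S: "S \<in> X" "{(u, 0), (v, 1)} \<subseteq> S"
  shows "S \<in> complex_join (subsets_avoiding Z {(v, 0), (u, 1)}) L"
proof -
  have "(S - Z) \<union> (S \<inter> Z) = S" by blast
  then have "S - Z \<in> L"
    using square_link_iff[of "S \<inter> Z" "S - Z"] S not_reversed_diagonal[OF S(1)] by auto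
  moreover have "S \<inter> Z \<in> subsets_avoiding Z {(v, 0), (u, 1)}"
    using not_reversed_diagonal[OF S(1)] by (auto simp: subsets_avoiding_def)
  moreover have "S = (S \<inter> Z) \<union> (S - Z)" by blast
  ultimately show ?thesis unfolding complex_join_def by blast
qed

lemma link_eq:
  assumes "z \<in> {(v, 0), (u, 1)}"
  shows "simplex_link X (Z - {z}) = L"
proof -
  have M: "Z - {z} \<subseteq> Z" "{(u, 0), (v, 1)} \<subseteq> Z - {z}" "\<not> {(v, 0), (u, 1)} \<subseteq> Z - {z}"
    using assms uv(1) by auto
  show ?thesis
  proof (intro subset_antisym subsetI)
    fix R assume R: "R \<in> simplex_link X (Z - {z})"
    then have RM: "R \<union> (Z - {z}) \<in> X" "R \<inter> (Z - {z}) = {}" by (auto simp: simplex_link_def)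
    \<comment> \<open>Disjointness from \<open>Z - {z}\<close> leaves \<open>z\<close> open, but
      with \<open>z\<close> the simplex would contain both diagonals.\<close>
    have "z \<notin> R" using not_reversed_diagonal[OF RM(1)] assms uv(1) by auto
    then have "R \<inter> Z = {}" using RM(2) by blast
    then show "R \<in> L" using square_link_iff[OF M] RM(1) by blast
  next
    fix R assume R: "R \<in> L"
    then have "R \<inter> Z = {}" by (simp add: square_link_def)
    moreover from this have "R \<union> (Z - {z}) \<in> X" using square_link_iff[OF M] R by blast
    moreover from this have "R \<in> X" by (rule staircase_subset[OF K]) blast
    ultimately show "R \<in> simplex_link X (Z - {z})" unfolding simplex_link_def by blast
  qed
qed

lemma keep_simplex:
  assumes "S \<in> X" "\<not> {(u, 0), (v, 1)} \<subseteq> S"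
  shows "S \<in> X'"
  using assms reversed unfolding staircase_scheme_def by auto

lemma flip_scheme:
  "X' = (X - complex_join (subsets_avoiding Z {(v, 0), (u, 1)}) L)
     \<union> complex_join (subsets_avoiding Z {(u, 0), (v, 1)}) L"
proof -
  interpret rev: edge_reversal K D' D v u by (rule reverse)
  have Z_eq: "{v, u} \<times> {0, 1} = Z" by auto
  have join': "complex_join (subsets_avoiding Z {(u, 0), (v, 1)}) L \<subseteq> X'"
    using rev.join_subset unfolding reverse_link Z_eq .
  show ?thesis
  proof (intro subset_antisym subsetI)
    fix S assume S: "S \<in> X'"
    show "S \<in> (X - complex_join (subsets_avoiding Z {(v, 0), (u, 1)}) L)
      \<union> complex_join (subsets_avoiding Z {(u, 0), (v, 1)}) L"
    proof (cases "{(v, 0), (u, 1)} \<subseteq> S")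
      case True
      then show ?thesis using rev.diagonal_in_join[OF S] unfolding reverse_link Z_eq by blast
    next
      case False
      \<comment> \<open>A simplex with neither diagonal may lie in the deleted join; its part in the
        square then avoids the old diagonal, so the added join contains it too.\<close>
      have "S \<in> complex_join (subsets_avoiding Z {(u, 0), (v, 1)}) L"
        if "S \<in> complex_join (subsets_avoiding Z {(v, 0), (u, 1)}) L"
      proof -
        obtain M R where M: "S = M \<union> R" "M \<subseteq> Z" "R \<in> L"
          using \<open>S \<in> complex_join (subsets_avoiding Z {(v, 0), (u, 1)}) L\<close>
          by (auto simp: complex_join_def subsets_avoiding_def)
        have "\<not> {(u, 0), (v, 1)} \<subseteq> M" using rev.not_reversed_diagonal[OF S] M(1) by blast
        then show ?thesis using M unfolding complex_join_def subsets_avoiding_def by blast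
      qed
      then show ?thesis using rev.keep_simplex[OF S False] by blast
    qed
  next
    fix S assume S: "S \<in> (X - complex_join (subsets_avoiding Z {(v, 0), (u, 1)}) L)
      \<union> complex_join (subsets_avoiding Z {(u, 0), (v, 1)}) L"
    then show "S \<in> X'" using join' diagonal_in_join keep_simplex by blast
  qed
qed

lemma flip:
  assumes T: "geometric_complex T" "vertex_scheme T = X"
    and T': "geometric_complex T'" "vertex_scheme T' = X'" and P: "Z \<subseteq> P"
  shows "flip P T T'"
proof -
  interpret rev: edge_reversal K D' D v u by (rule reverse)
  have Z_eq: "{v, u} \<times> {0, 1} = Z" by auto
  let ?p = "{(v, 0), (u, 1 :: real)}" and ?m = "{(u, 0), (v, 1 :: real)}"
  have avoid: "subsets_avoiding Z ?p \<subseteq> X"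
    using join_subset complex_join_empty_right[OF empty_in_link] by blast
  have avoid': "subsets_avoiding Z ?m \<subseteq> X'"
    using rev.join_subset complex_join_empty_right[OF empty_in_link]
    unfolding reverse_link Z_eq by blast
  \<comment> \<open>A proper subset of the square misses a vertex of some diagonal, so it is a
    simplex of \<open>T\<close> or of \<open>T'\<close>, and hence independent.\<close>
  have "\<not> affine_dependent Y" if Y: "Y \<subset> Z" for Y
  proof -
    have "Y \<in> subsets_avoiding Z ?p \<union> subsets_avoiding Z ?m"
      using Y unfolding subsets_avoiding_def by auto
    then have "Y \<in> vertex_scheme T \<or> Y \<in> vertex_scheme T'" using avoid avoid' T T' by auto
    then show ?thesis using scheme_hull(1) T(1) T'(1) by blast
  qed
  then have "minimal_affine_dependent Z"
    using square_affine_dependent[OF uv(1)] by (simp add: minimal_affine_dependent_def)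
  moreover have "convex hull ?p \<inter> convex hull ?m \<noteq> {}"
    using diagonals_cross[OF uv(1)] bary_imp_hull by (metis IntI empty_iff)
  moreover have "Z = ?p \<union> ?m" "?p \<inter> ?m = {}" using uv(1) by auto
  ultimately have "circuit_partition Z ?p ?m" by (simp add: circuit_partition_def)
  moreover have "\<forall>M\<in>maximal_simplices (subsets_avoiding Z ?p). simplex_link (vertex_scheme T) M = L"
    using link_eq T(2) by (subst maximal_subsets_avoiding) auto
  ultimately show ?thesis
    unfolding flip_def using P avoid T(2) T'(2) flip_scheme by metis
qed

end

theorem theorem1p5:
  fixes A :: "'a::euclidean_space set" and K :: "'a set set"
  assumes "finite A"
    and "simplicial_subcomplex_of_faces A K"
  shows "\<exists>\<Phi> :: ('a \<times> real) set set \<Rightarrow> ('a \<times> 'a) set.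
           bij_betw \<Phi> {T. prism_triangulation A K T} {D. locally_acyclic_orientation K D} \<and>
           (\<forall>T T'. prism_triangulation A K T \<longrightarrow> prism_triangulation A K T' \<longrightarrow>
              (flip (A \<times> {0, 1}) T T' \<longleftrightarrow> single_edge_reversal (\<Phi> T) (\<Phi> T')))"
proof (intro exI conjI allI impI)
  show "bij_betw triangulation_arcs {T. prism_triangulation A K T} {D. locally_acyclic_orientation K D}"
    by (rule bij_betw_triangulation_arcs[OF assms])
  note K = K_complex[OF assms]
  fix T T' assume T: "prism_triangulation A K T" and T': "prism_triangulation A K T'"
  let ?D = "triangulation_arcs T" and ?D' = "triangulation_arcs T'"
  note D = triangulation_arcs_locally_acyclic[OF assms T] triangulation_scheme[OF assms T]
  note D' = triangulation_arcs_locally_acyclic[OF assms T'] triangulation_scheme[OF assms T']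
  have ori: "orientation K ?D" "orientation K ?D'"
    using D(1) D'(1) by (simp_all add: locally_acyclic_orientation_def)
  show "flip (A \<times> {0, 1}) T T' \<longleftrightarrow> single_edge_reversal ?D ?D'"
  proof
    assume "flip (A \<times> {0, 1}) T T'"
    then show "single_edge_reversal ?D ?D'"
      using flip_imp_reversal[OF K ori(1) D(2) ori(2) D'(2)] staircase_in_A(2)[OF assms] by blast
  next
    assume "single_edge_reversal ?D ?D'"
    then obtain u v where uv: "(u, v) \<in> ?D" "?D' = insert (v, u) (?D - {(u, v)})"
      by (auto simp: single_edge_reversal_def)
    interpret reversal: edge_reversal K ?D ?D' u v
      by unfold_locales (rule K D(1) D'(1) uv)+
    have "{u, v} \<times> {0, 1} \<subseteq> A \<times> {0, 1 :: real}"
      using scheme_in_A[OF assms, of "{u, v}"] orientation_arc(1)[OF K ori(1) uv(1)] by auto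
    then show "flip (A \<times> {0, 1}) T T'"
      using reversal.flip D(2) D'(2) triangulation_complex T T' by blast
  qed
qed

end
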